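(* Let $b\ge3$, $D\subset\{0,\dots,b-1\}$ with $0\in D$ and $2\le|D|<b$, and list $\mathcal C=\mathcal C_{b,D}$ increasingly as $k_1<k_2<\cdots$. Let $P(x,y)=\sum_{i,j}c_{ij}x^iy^j$ be a real polynomial such that $c_{ij}$ is irrational for some $(i,j)\neq(0,0)$. Then $$\lim_{N-M\to\infty}\frac1{N-M}\sum_{M<n\le N}e\big(P(k_n,s_b(k_n))\big)=0$$ (uniformly in $M$: for every $\eta>0$ there is $L$ such that the average has modulus $<\eta$ whenever $0\le M<N$, $N-M\ge L$). Consequently, for every polynomial map $p=(p_1,p_2):\mathbb R^2\to\mathbb R^2$ such that $m\cdot p$ has an irrational non-constant coefficient for every $m\in\mathbb Z^2\setminus\{0\}$, the sequence $p(k_n,s_b(k_n))$ is uniformly distributed modulo $1$ in $[0,1)^2$, and the averages of $e(m\cdot p(k_n,s_b(k_n)))$ over $M<n\le N$ tend to $0$ as $N-M\to\infty$ for every $m\in\mathbb Z^2\setminus\{0\}$.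
   Context: $\mathcal C_{b,D}=\{\sum_{j=0}^{k} d_j b^j : k\in\mathbb N_0,\ d_j\in D\}$; $s_b(k)$ is the base-$b$ sum of digits; $e(x)=e^{2\pi ix}$. A sequence $(x_n)\subset\mathbb R^2$ is uniformly distributed mod 1 if the fractional parts satisfy $\frac1N\#\{n\le N:\{x_n\}\in(a,b)\times(c,d)\}\to(b-a)(d-c)$ for all subrectangles of $[0,1)^2$. *)

theory Defs
  imports "HOL-Analysis.Analysis" "HOL-Library.Infinite_Set"
begin

definition digit_set :: "nat \<Rightarrow> nat set \<Rightarrow> nat set" where
  "digit_set b D = {(\<Sum>j\<le>k. d j * b ^ j) | k d. \<forall>j\<le>k. d j \<in> D}"

text \<open>k_n, n = 1,2,...: the n-th element of C_{b,D} in increasing order (enumerate is 0-based).\<close>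
definition kseq :: "nat \<Rightarrow> nat set \<Rightarrow> nat \<Rightarrow> nat" where
  "kseq b D n = enumerate (digit_set b D) (n - 1)"

text \<open>Base-b sum of digits (digits beyond position k vanish since b^j > k for j > k when b >= 2).\<close>
definition digsum :: "nat \<Rightarrow> nat \<Rightarrow> nat" where
  "digsum b k = (\<Sum>j\<le>k. (k div b ^ j) mod b)"

definition ee :: "real \<Rightarrow> complex" where
  "ee x = exp (2 * of_real pi * \<i> * of_real x)"

definition poly2 :: "nat \<Rightarrow> (nat \<Rightarrow> nat \<Rightarrow> real) \<Rightarrow> real \<Rightarrow> real \<Rightarrow> real" where
  "poly2 d c x y = (\<Sum>i\<le>d. \<Sum>j\<le>d. c i j * x ^ i * y ^ j)"

definition has_irr_nonconst_coeff :: "nat \<Rightarrow> (nat \<Rightarrow> nat \<Rightarrow> real) \<Rightarrow> bool" where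
  "has_irr_nonconst_coeff d c \<longleftrightarrow> (\<exists>i\<le>d. \<exists>j\<le>d. (i, j) \<noteq> (0, 0) \<and> c i j \<notin> \<rat>)"

definition avg_tends_zero :: "(nat \<Rightarrow> complex) \<Rightarrow> bool" where
  "avg_tends_zero f \<longleftrightarrow> (\<forall>\<eta>>0. \<exists>L. \<forall>M N. M < N \<and> N - M \<ge> L \<longrightarrow>
      norm ((\<Sum>n\<in>{M<..N}. f n) / of_nat (N - M)) < \<eta>)"

definition ud_mod1_2 :: "(nat \<Rightarrow> real \<times> real) \<Rightarrow> bool" where
  "ud_mod1_2 x \<longleftrightarrow> (\<forall>a b c d. 0 \<le> a \<and> a < b \<and> b \<le> 1 \<and> 0 \<le> c \<and> c < d \<and> d \<le> 1 \<longrightarrow>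
     ((\<lambda>N. real (card {n\<in>{1..N}. frac (fst (x n)) \<in> {a<..<b} \<and> frac (snd (x n)) \<in> {c<..<d}}) / real N)
       \<longlonglongrightarrow> (b - a) * (d - c)))"

end

theory Submission
  imports Defs
begin

text \<open>
  Let \<open>q = card D\<close> and let \<open>\<kappa> n\<close> be the \<open>n\<close>-th element of the digit set, counted from 0. Writing \<open>n\<close> in base
  \<open>q\<close> and replacing each digit by the corresponding element of \<open>D\<close> gives
  \<open>\<kappa> (q ^ m * n + r) = b ^ m * \<kappa> n + \<kappa> r\<close> for \<open>r < q ^ m\<close>, and the digit sums \<open>\<sigma> n\<close> of \<open>\<kappa> n\<close> add up
  likewise. Hence it suffices that the averages of \<open>e (P (b ^ m * u + \<kappa> r, v + \<sigma> r))\<close> over \<open>r < q ^ m\<close> tend to 0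
  uniformly in \<open>u\<close> and \<open>v\<close>.

  If \<open>P\<close> is linear, the average is a product over the digits, and its factors cannot tend to 1 unless both
  coefficients are rational. If the leading form of \<open>P\<close> has an irrational coefficient, Cauchy--Schwarz
  applied to a fixed number of low digits replaces \<open>P\<close> by differences of smaller degree. Those without an
  irrational leading coefficient come from pairs of digit strings on which a fixed integral linear form in
  \<open>(\<kappa>, \<sigma>)\<close> agrees, and by the linear case such pairs have small density. In general, \<open>e\<close> of the
  part of \<open>P\<close> with rational coefficients is periodic, and expanding it in characters of a finite group perturbs the
  irrational part only by rational linear terms.

  Uniform distribution follows from Weyl's criterion: indicators of intervals are squeezed between trigonometric
  polynomials, which exist by Stone--Weierstrass on the unit circle.
\<close>

section \<open>Exponential sums\<close>

lemma ee_eq_cis: "ee x = cis (2 * pi * x)"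
  by (simp add: ee_def cis_conv_exp mult_ac)

lemma norm_ee [simp]: "norm (ee x) = 1"
  by (simp add: ee_eq_cis)

lemma ee_0 [simp]: "ee 0 = 1"
  by (simp add: ee_eq_cis)

lemma ee_add: "ee (x + y) = ee x * ee y"
  by (simp add: ee_eq_cis cis_mult algebra_simps)

lemma ee_minus: "ee (- x) = cnj (ee x)"
  by (simp add: ee_eq_cis cis_cnj)

lemma ee_diff: "ee (x - y) = ee x * cnj (ee y)"
  using ee_add[of x "- y"] by (simp add: ee_minus)

lemma ee_of_nat_mult: "ee (of_nat n * x) = ee x ^ n"
  unfolding ee_eq_cis Complex.DeMoivre by (simp add: mult_ac)

lemma ee_eq_1_iff: "ee x = 1 \<longleftrightarrow> x \<in> \<int>"
proof
  assume "ee x = 1"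
  then have "cos (2 * pi * x) = 1"
    by (simp add: ee_eq_cis complex_eq_iff)
  then obtain n :: int where "2 * pi * x = of_int n * 2 * pi"
    by (auto simp: cos_one_2pi_int)
  then have "x = of_int n" by simp
  then show "x \<in> \<int>" by simp
qed (simp add: ee_eq_cis)

lemma ee_of_int [simp]: "ee (of_int n) = 1"
  by (simp add: ee_eq_1_iff)

lemma ee_eq_iff: "ee x = ee y \<longleftrightarrow> x - y \<in> \<int>"
proof -
  have "ee x = ee (x - y) * ee y" by (simp flip: ee_add)
  moreover have "ee y \<noteq> 0" using norm_ee[of y] by (metis norm_zero zero_neq_one)
  ultimately show ?thesis by (simp flip: ee_eq_1_iff)
qed

lemma ee_frac: "ee (frac x) = ee x"
  by (simp add: ee_eq_iff frac_def)

lemma continuous_on_ee [continuous_intros]: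
  "continuous_on S f \<Longrightarrow> continuous_on S (\<lambda>x. ee (f x))"
  unfolding ee_def by (intro continuous_intros)

lemma norm_sum_ee_squared:
  "complex_of_real ((norm (\<Sum>i\<in>I. ee (f i)))\<^sup>2) = (\<Sum>i\<in>I. \<Sum>j\<in>I. ee (f i - f j))"
  by (simp add: complex_norm_square sum_product ee_diff del: of_real_power)

lemma sum_le_of_rare_exceptions:
  fixes f :: "'a \<Rightarrow> real"
  assumes "finite A" "B \<subseteq> A" "0 \<le> \<delta>" "0 \<le> M" and rare: "real (card B) \<le> \<delta> * real (card A)"
    and typical: "\<And>p. p \<in> A - B \<Longrightarrow> f p \<le> \<delta> * M" and exceptional: "\<And>p. p \<in> B \<Longrightarrow> f p \<le> M"
  shows "sum f A \<le> 2 * \<delta> * M * real (card A)"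
proof -
  have "sum f A = sum f (A - B) + sum f B"
    using assms by (intro sum.subset_diff) auto
  also have "\<dots> \<le> (\<Sum>p\<in>A - B. \<delta> * M) + (\<Sum>p\<in>B. M)"
    by (intro add_mono sum_mono typical exceptional)
  also have "\<dots> \<le> (\<Sum>p\<in>A. \<delta> * M) + (\<delta> * real (card A)) * M"
    using assms by (intro add_mono sum_mono2) (auto intro: mult_right_mono)
  finally show ?thesis by (simp add: mult_ac)
qed

text \<open>The kernel \<open>\<bar>\<Sum>t<T. e (t x)\<bar>\<^sup>2\<close> is nonnegative and equals \<open>T\<^sup>2\<close> at \<open>x = 0\<close>, so its sum over the
  differences \<open>x = g r - g s\<close> bounds the number of coincidences.\<close>

lemma card_coincidences_le:
  fixes g :: "'a \<Rightarrow> real"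
  assumes "finite R"
  shows "(real T)\<^sup>2 * real (card {(r, s) \<in> R \<times> R. g r = g s})
    \<le> (\<Sum>t<T. \<Sum>t'<T. (norm (\<Sum>r\<in>R. ee ((real t - real t') * g r)))\<^sup>2)"
proof -
  let ?kernel = "\<lambda>x. (norm (\<Sum>t<T. ee (real t * x)))\<^sup>2"
  let ?C = "{(r, s) \<in> R \<times> R. g r = g s}"
  let ?term = "\<lambda>t t' r s. ee ((real t - real t') * (g r - g s))"
  have "complex_of_real (\<Sum>t<T. \<Sum>t'<T. (norm (\<Sum>r\<in>R. ee ((real t - real t') * g r)))\<^sup>2)
      = (\<Sum>t<T. \<Sum>t'<T. \<Sum>r\<in>R. \<Sum>s\<in>R. ?term t t' r s)"
    by (simp add: norm_sum_ee_squared right_diff_distrib del: of_real_power)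
  also have "\<dots> = (\<Sum>r\<in>R. \<Sum>s\<in>R. \<Sum>t<T. \<Sum>t'<T. ?term t t' r s)"
    unfolding sum.cartesian_product
    by (rule sum.reindex_bij_witness[of _ "\<lambda>(r, s, t, t'). (t, t', r, s)" "\<lambda>(t, t', r, s). (r, s, t, t')"]) auto
  also have "\<dots> = complex_of_real (\<Sum>r\<in>R. \<Sum>s\<in>R. ?kernel (g r - g s))"
    by (simp add: norm_sum_ee_squared left_diff_distrib del: of_real_power)
  finally have dual: "(\<Sum>t<T. \<Sum>t'<T. (norm (\<Sum>r\<in>R. ee ((real t - real t') * g r)))\<^sup>2)
      = (\<Sum>r\<in>R. \<Sum>s\<in>R. ?kernel (g r - g s))"
    by (simp only: of_real_eq_iff)
  have "(real T)\<^sup>2 * real (card ?C) = (\<Sum>(r, s)\<in>?C. ?kernel (g r - g s))"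
    by (simp add: case_prod_unfold)
  also have "\<dots> \<le> (\<Sum>(r, s)\<in>R \<times> R. ?kernel (g r - g s))"
    using assms by (intro sum_mono2) auto
  finally show ?thesis
    unfolding dual unfolding sum.cartesian_product .
qed

section \<open>Alignment of unit vectors and rationality\<close>

lemma diff_tendsto_0_of_norm_add_tendsto_2:
  fixes z w :: "'b \<Rightarrow> 'a::real_inner"
  assumes "\<And>n. norm (z n) = 1" "\<And>n. norm (w n) = 1" "((\<lambda>n. norm (z n + w n)) \<longlongrightarrow> 2) F"
  shows "((\<lambda>n. z n - w n) \<longlongrightarrow> 0) F"
proof -
  have "(norm (z n - w n))\<^sup>2 = 4 - (norm (z n + w n))\<^sup>2" for n
    using dot_norm[of "z n" "w n"] dot_norm_neg[of "z n" "w n"] assms(1,2)[of n] by simp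
  then have "norm (z n - w n) = sqrt (4 - (norm (z n + w n))\<^sup>2)" for n
    by (metis norm_ge_zero real_sqrt_unique)
  moreover have "((\<lambda>n. sqrt (4 - (norm (z n + w n))\<^sup>2)) \<longlongrightarrow> sqrt (4 - 2\<^sup>2)) F"
    by (intro tendsto_intros assms(3))
  ultimately show ?thesis by (subst tendsto_norm_zero_iff[symmetric]) simp
qed

lemma norm_sum_le_norm_add:
  fixes z :: "'i \<Rightarrow> 'a::real_normed_vector"
  assumes "finite I" "i \<in> I" "j \<in> I" "i \<noteq> j" "\<And>k. k \<in> I \<Longrightarrow> norm (z k) \<le> 1"
  shows "norm (\<Sum>k\<in>I. z k) \<le> norm (z i + z j) + (real (card I) - 2)"
proof -
  have "{i, j} \<subseteq> I" using assms by blast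
  then have "(\<Sum>k\<in>I. z k) = (z i + z j) + (\<Sum>k\<in>I - {i, j}. z k)"
    using assms by (subst sum.subset_diff[of "{i, j}"]) (simp_all add: add.commute)
  moreover have "norm (\<Sum>k\<in>I - {i, j}. z k) \<le> real (card (I - {i, j}))"
    using sum_norm_le[of "I - {i, j}" z "\<lambda>_. 1"] assms by simp
  moreover have "card (I - {i, j}) + 2 = card I"
    using assms \<open>{i, j} \<subseteq> I\<close> card_Diff_subset[of "{i, j}" I] card_mono[of I "{i, j}"] by simp
  ultimately show ?thesis
    using norm_triangle_ineq[of "z i + z j" "\<Sum>k\<in>I - {i, j}. z k"] by simp
qed

lemma diff_tendsto_0_of_norm_sum_tendsto_card:
  fixes z :: "'i \<Rightarrow> 'b \<Rightarrow> 'a::real_inner"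
  assumes "finite I" "i \<in> I" "j \<in> I" and unit: "\<And>k n. k \<in> I \<Longrightarrow> norm (z k n) = 1"
    and lim: "((\<lambda>n. norm (\<Sum>k\<in>I. z k n)) \<longlongrightarrow> real (card I)) F"
  shows "((\<lambda>n. z i n - z j n) \<longlongrightarrow> 0) F"
proof (cases "i = j")
  case False
  have "((\<lambda>n. norm (z i n + z j n)) \<longlongrightarrow> 2) F"
  proof (rule real_tendsto_sandwich)
    have "norm (\<Sum>k\<in>I. z k n) - (real (card I) - 2) \<le> norm (z i n + z j n)" for n
      using norm_sum_le_norm_add[of I i j "\<lambda>k. z k n"] assms False by simp
    then show "\<forall>\<^sub>F n in F. norm (\<Sum>k\<in>I. z k n) - (real (card I) - 2) \<le> norm (z i n + z j n)"
      by (rule always_eventually[OF allI])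
    have "norm (z i n + z j n) \<le> 2" for n
      using norm_triangle_ineq[of "z i n" "z j n"] unit assms(2,3) by simp
    then show "\<forall>\<^sub>F n in F. norm (z i n + z j n) \<le> 2"
      by (rule always_eventually[OF allI])
    show "((\<lambda>n. norm (\<Sum>k\<in>I. z k n) - (real (card I) - 2)) \<longlongrightarrow> 2) F"
      using tendsto_diff[OF lim tendsto_const[of "real (card I) - 2"]] by simp
  qed simp
  then show ?thesis
    using unit assms(2,3) by (intro diff_tendsto_0_of_norm_add_tendsto_2)
qed simp

lemma tendsto_1_of_prod_bounded_below:
  fixes f :: "nat \<Rightarrow> real"
  assumes unit_interval: "\<And>j. 0 \<le> f j" "\<And>j. f j \<le> 1"
    and bounded: "\<epsilon> > 0" "\<And>m. \<epsilon> \<le> (\<Prod>j<m. f j)"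
  shows "f \<longlonglongrightarrow> 1"
proof -
  have nonzero: "f j \<noteq> 0" for j
    using bounded(2)[of "Suc j"] bounded(1) by auto
  have lower: "\<epsilon> \<le> (\<Prod>j\<le>m. f j)" for m
    using bounded(2)[of "Suc m"] by (simp only: lessThan_Suc_atMost)
  have "decseq (\<lambda>m. \<Prod>j\<le>m. f j)"
    by (rule decseq_SucI) (simp add: mult_left_le mult_left_le_one_le prod_nonneg unit_interval)
  then obtain l where l: "(\<lambda>m. \<Prod>j\<le>m. f j) \<longlonglongrightarrow> l"
    using decseq_convergent lower by metis
  have "\<epsilon> \<le> l"
    by (rule LIMSEQ_le_const[OF l]) (use lower in blast)
  then have "convergent_prod f"
    using l bounded(1) by (force simp: convergent_prod_iff_nz_lim nonzero)
  then show ?thesis by (rule convergent_prod_imp_LIMSEQ)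
qed

lemma rational_of_ee_power_tendsto_1:
  fixes y :: real and b :: nat
  assumes b: "b \<ge> 2" and lim: "(\<lambda>j. ee (y * real b ^ j)) \<longlonglongrightarrow> 1"
  shows "y \<in> \<rat>"
proof -
  define z where "z j = ee (y * real b ^ j)" for j
  have z_Suc: "z (Suc j) = z j ^ b" for j
    by (simp add: z_def mult_ac flip: ee_of_nat_mult)
  have "z \<longlonglongrightarrow> 1" using lim by (simp add: z_def[abs_def])
  then have "(\<lambda>j. norm (\<Sum>i<b. z j ^ i)) \<longlonglongrightarrow> norm (\<Sum>i<b. (1::complex) ^ i)"
    by (intro tendsto_intros)
  \<comment> \<open>So 1 is a repelling fixed point of \<open>z \<mapsto> z ^ b\<close>: an orbit can only converge to it by reaching it.\<close>
  then have "\<forall>\<^sub>F j in sequentially. norm (\<Sum>i<b. z j ^ i) > 1"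
    by (rule order_tendstoD) (use b in simp)
  then obtain J where J: "\<And>j. j \<ge> J \<Longrightarrow> norm (\<Sum>i<b. z j ^ i) > 1"
    by (auto simp: eventually_sequentially)
  have repelled: "norm (z j - 1) \<le> norm (z (Suc j) - 1)" if "j \<ge> J" for j
  proof -
    have "norm (z (Suc j) - 1) = norm (z j - 1) * norm (\<Sum>i<b. z j ^ i)"
      by (simp add: z_Suc power_diff_1_eq norm_mult)
    then show ?thesis using J[OF that] by (simp add: mult_le_cancel_left1 less_imp_le)
  qed
  have "norm (z J - 1) \<le> norm (z j - 1)" if "j \<ge> J" for j
    using that by (induction rule: dec_induct) (auto intro: order.trans repelled)
  moreover have "(\<lambda>j. norm (z j - 1)) \<longlonglongrightarrow> norm (1 - 1 :: complex)"
    by (intro tendsto_intros \<open>z \<longlonglongrightarrow> 1\<close>)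
  ultimately have "norm (z J - 1) \<le> norm (1 - 1 :: complex)"
    by (blast intro: LIMSEQ_le_const)
  then have "y * real b ^ J \<in> \<int>" by (simp add: z_def ee_eq_1_iff)
  then have "y * real b ^ J \<in> \<rat>" using Ints_subset_Rats by blast
  then show ?thesis using b by (simp add: Rats_mult_iff)
qed

lemma rational_of_ee_affine_power_tendsto_1:
  fixes A B :: real and b :: nat
  assumes b: "b \<ge> 2" and lim: "(\<lambda>j. ee (A * real b ^ j + B)) \<longlonglongrightarrow> 1"
  shows "A \<in> \<rat> \<and> B \<in> \<rat>"
proof
  define z where "z j = ee (A * real b ^ j + B)" for j
  have z: "z \<longlonglongrightarrow> 1" using lim by (simp add: z_def[abs_def])
  have "(\<lambda>j. z (Suc j) * cnj (z j)) \<longlonglongrightarrow> 1 * cnj 1"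
    by (intro tendsto_intros LIMSEQ_Suc z)
  moreover have "z (Suc j) * cnj (z j) = ee (A * (real b - 1) * real b ^ j)" for j
    unfolding z_def ee_diff[symmetric] by (simp add: algebra_simps)
  ultimately have "A * (real b - 1) \<in> \<rat>"
    using rational_of_ee_power_tendsto_1[OF b] by simp
  then show "A \<in> \<rat>" using b by (simp add: Rats_mult_iff)
  have "(\<lambda>j. z (Suc j) * cnj (z j ^ b)) \<longlonglongrightarrow> 1 * cnj (1 ^ b)"
    by (intro tendsto_intros LIMSEQ_Suc z)
  moreover have "z (Suc j) * cnj (z j ^ b) = ee (B * (1 - real b))" for j
    unfolding z_def ee_of_nat_mult[symmetric] ee_diff[symmetric] by (simp add: algebra_simps)
  ultimately have "B * (1 - real b) \<in> \<int>" by (simp add: LIMSEQ_const_iff ee_eq_1_iff)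
  then have "B * (1 - real b) \<in> \<rat>" using Ints_subset_Rats by blast
  then show "B \<in> \<rat>" using b by (simp add: Rats_mult_iff)
qed

section \<open>Digit maps\<close>

definition digit_map :: "nat \<Rightarrow> nat \<Rightarrow> (nat \<Rightarrow> nat) \<Rightarrow> nat \<Rightarrow> nat" where
  "digit_map b q \<delta> n = (\<Sum>j\<le>n. \<delta> (n div q ^ j mod q) * b ^ j)"

lemma digit_induct [consumes 1, case_names zero digit]:
  fixes q :: nat
  assumes "q \<ge> 2" "P 0" "\<And>n r. r < q \<Longrightarrow> P n \<Longrightarrow> P (q * n + r)"
  shows "P n"
proof (induction n rule: less_induct)
  case (less n)
  show ?case
  proof (cases "n = 0")
    case False
    then have "P (n div q)" using assms(1) by (intro less.IH) simp
    then have "P (q * (n div q) + n mod q)" using assms(1) by (intro assms(3)) simp_all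
    then show ?thesis by simp
  qed (use assms(2) in simp)
qed

locale digit_substitution =
  fixes q :: nat and \<delta> :: "nat \<Rightarrow> nat"
  assumes q_ge_2: "q \<ge> 2" and \<delta>_0: "\<delta> 0 = 0"
begin

lemma digit_map_eq_sum_lessThan:
  assumes "n < K"
  shows "digit_map b q \<delta> n = (\<Sum>j<K. \<delta> (n div q ^ j mod q) * b ^ j)"
  unfolding digit_map_def
proof (rule sum.mono_neutral_left)
  show "\<forall>j\<in>{..<K} - {..n}. \<delta> (n div q ^ j mod q) * b ^ j = 0"
  proof
    fix j assume "j \<in> {..<K} - {..n}"
    then have "n < j" by simp
    also have "j < q ^ j" using q_ge_2 by (intro power_gt_expt) simp
    finally show "\<delta> (n div q ^ j mod q) * b ^ j = 0" using \<delta>_0 by simp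
  qed
qed (use assms in auto)

lemma digit_map_0: "digit_map b q \<delta> 0 = 0"
  by (simp add: digit_map_def \<delta>_0)

lemma digit_map_mult_add:
  assumes "r < q"
  shows "digit_map b q \<delta> (q * n + r) = b * digit_map b q \<delta> n + \<delta> r"
proof -
  define K where "K = Suc (q * n + r)"
  have "n \<le> q * n" using q_ge_2 by simp
  then have "n < K" unfolding K_def by linarith
  have "digit_map b q \<delta> (q * n + r) = (\<Sum>j<Suc K. \<delta> ((q * n + r) div q ^ j mod q) * b ^ j)"
    by (rule digit_map_eq_sum_lessThan) (simp add: K_def)
  also have "\<dots> = \<delta> r + (\<Sum>j<K. \<delta> ((q * n + r) div q ^ Suc j mod q) * b ^ Suc j)"
    by (subst sum.lessThan_Suc_shift) (use assms in simp)
  also have "(\<Sum>j<K. \<delta> ((q * n + r) div q ^ Suc j mod q) * b ^ Suc j)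
      = b * (\<Sum>j<K. \<delta> (n div q ^ j mod q) * b ^ j)"
    using assms by (simp add: div_mult2_eq sum_distrib_left mult_ac)
  also have "(\<Sum>j<K. \<delta> (n div q ^ j mod q) * b ^ j) = digit_map b q \<delta> n"
    using digit_map_eq_sum_lessThan[OF \<open>n < K\<close>] ..
  finally show ?thesis by simp
qed

lemma digit_map_digit: "r < q \<Longrightarrow> digit_map b q \<delta> r = \<delta> r"
  using digit_map_mult_add[of r b 0] by (simp add: digit_map_0)

lemma digit_map_concat:
  "r < q ^ m \<Longrightarrow> digit_map b q \<delta> (q ^ m * n + r) = b ^ m * digit_map b q \<delta> n + digit_map b q \<delta> r"
proof (induction m arbitrary: r)
  case 0
  then show ?case by (simp add: digit_map_0)
next
  case (Suc m)
  define k s where "k = r div q" and "s = r mod q"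
  have r: "r = q * k + s" and s: "s < q"
    using q_ge_2 by (simp_all add: k_def s_def)
  have k: "k < q ^ m"
    using Suc.prems q_ge_2 by (simp add: k_def less_mult_imp_div_less mult.commute)
  have "q ^ Suc m * n + r = q * (q ^ m * n + k) + s"
    by (simp add: r algebra_simps)
  then have "digit_map b q \<delta> (q ^ Suc m * n + r) = b * digit_map b q \<delta> (q ^ m * n + k) + \<delta> s"
    by (simp only: digit_map_mult_add[OF s])
  also have "\<dots> = b ^ Suc m * digit_map b q \<delta> n + (b * digit_map b q \<delta> k + \<delta> s)"
    unfolding Suc.IH[OF k] by (simp add: algebra_simps)
  also have "b * digit_map b q \<delta> k + \<delta> s = digit_map b q \<delta> r"
    by (simp only: r digit_map_mult_add[OF s])
  finally show ?case .
qed

lemma strict_mono_digit_map: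
  assumes mono: "strict_mono_on {..<q} \<delta>" and less: "\<And>r. r < q \<Longrightarrow> \<delta> r < b"
  shows "strict_mono (digit_map b q \<delta>)"
proof (rule strict_monoI)
  show "m < n \<Longrightarrow> digit_map b q \<delta> m < digit_map b q \<delta> n" for m n
    using q_ge_2
  proof (induction n arbitrary: m rule: digit_induct)
    case (digit n r)
    define k s where "k = m div q" and "s = m mod q"
    have m: "m = q * k + s" and s: "s < q" using q_ge_2 by (simp_all add: k_def s_def)
    have "k \<le> n"
      using div_le_mono[of m "q * n + r" q] digit q_ge_2 by (simp add: k_def)
    then consider "k = n" | "k < n" by linarith
    then have "b * digit_map b q \<delta> k + \<delta> s < b * digit_map b q \<delta> n + \<delta> r"
    proof cases
      case 1
      then have "s < r" using digit.prems m by simp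
      then show ?thesis
        using 1 mono s digit.hyps by (simp add: strict_mono_on_def)
    next
      case 2
      then have "Suc (digit_map b q \<delta> k) \<le> digit_map b q \<delta> n"
        using digit.IH by (simp add: Suc_le_eq)
      then have "b * Suc (digit_map b q \<delta> k) \<le> b * digit_map b q \<delta> n" by (rule mult_le_mono2)
      then show ?thesis using less[OF s] by simp
    qed
    then show ?case
      unfolding m by (simp only: digit_map_mult_add s digit.hyps)
  qed simp
qed

lemma range_digit_map:
  assumes bij: "bij_betw \<delta> {..<q} D"
  shows "range (digit_map b q \<delta>) = digit_set b D"
proof (intro equalityI subsetI)
  have "\<delta> r \<in> D" if "r < q" for r using bij that by (auto simp: bij_betw_def)
  then have "digit_map b q \<delta> n \<in> digit_set b D" for n
    using q_ge_2 unfolding digit_set_def digit_map_def mem_Collect_eq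
    by (intro exI[of _ n] exI[of _ "\<lambda>j. \<delta> (n div q ^ j mod q)"]) simp
  then show "x \<in> digit_set b D" if "x \<in> range (digit_map b q \<delta>)" for x using that by auto
  have digit: "\<exists>r<q. d = \<delta> r" if "d \<in> D" for d
    using bij that by (force simp: bij_betw_def)
  have "(\<Sum>j\<le>k. d j * b ^ j) \<in> range (digit_map b q \<delta>)" if "\<forall>j\<le>k. d j \<in> D" for k d
    using that
  proof (induction k arbitrary: d)
    case 0
    then obtain r where "r < q" "d 0 = \<delta> r" using digit by blast
    then have "(\<Sum>j\<le>0. d j * b ^ j) = digit_map b q \<delta> r" by (simp add: digit_map_digit)
    then show ?case by (rule range_eqI)
  next
    case (Suc k)
    obtain r where r: "r < q" "d 0 = \<delta> r" using digit Suc.prems by blast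
    obtain n where n: "(\<Sum>j\<le>k. d (Suc j) * b ^ j) = digit_map b q \<delta> n"
      using Suc.IH[of "\<lambda>j. d (Suc j)"] Suc.prems by auto
    have "(\<Sum>j\<le>Suc k. d j * b ^ j) = b * (\<Sum>j\<le>k. d (Suc j) * b ^ j) + d 0"
      by (simp only: sum.atMost_Suc_shift) (simp add: sum_distrib_left mult_ac)
    also have "\<dots> = digit_map b q \<delta> (q * n + r)"
      by (simp add: n r digit_map_mult_add)
    finally show ?case by (rule range_eqI)
  qed
  then show "x \<in> range (digit_map b q \<delta>)" if "x \<in> digit_set b D" for x
    using that unfolding digit_set_def by auto
qed

lemma digsum_digit_map:
  assumes "b \<ge> 2" "\<And>r. r < q \<Longrightarrow> \<delta> r < b"
  shows "digsum b (digit_map b q \<delta> n) = digit_map 1 q \<delta> n"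
  using q_ge_2
proof (induction n rule: digit_induct)
  case zero
  then show ?case by (simp add: digit_map_0 digsum_def)
next
  case (digit n r)
  interpret base_b: digit_substitution b "\<lambda>d. d" by unfold_locales (use assms in auto)
  have digsum: "digsum b = digit_map 1 b (\<lambda>d. d)"
    by (simp add: digsum_def digit_map_def fun_eq_iff)
  have "digsum b (digit_map b q \<delta> (q * n + r)) = digsum b (b * digit_map b q \<delta> n + \<delta> r)"
    by (simp only: digit_map_mult_add digit)
  also have "\<dots> = digsum b (digit_map b q \<delta> n) + \<delta> r"
    using base_b.digit_map_mult_add[of "\<delta> r" 1] assms digit by (simp add: digsum)
  also have "\<dots> = digit_map 1 q \<delta> (q * n + r)"
    using digit_map_mult_add[of r 1 n] digit by simp
  finally show ?case .
qed

end

lemma enumerate_range_strict_mono: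
  fixes f :: "nat \<Rightarrow> nat"
  assumes "strict_mono f"
  shows "enumerate (range f) n = f n"
proof (induction n)
  case 0
  have "(LEAST k. k \<in> range f) = f 0"
    by (rule Least_equality) (use assms in \<open>auto simp: strict_mono_less_eq\<close>)
  then show ?case by (simp add: enumerate_0)
next
  case (Suc n)
  have "infinite (range f)"
    using assms by (intro range_inj_infinite strict_mono_imp_inj_on)
  then have "enumerate (range f) (Suc n) = (LEAST s. s \<in> range f \<and> f n < s)"
    by (simp add: enumerate_Suc'' Suc)
  also have "\<dots> = f (Suc n)"
    by (rule Least_equality) (use assms in \<open>auto simp: strict_mono_less_eq strict_mono_less\<close>)
  finally show ?case .
qed

lemma enumerate_0_eq_0: "0 \<in> S \<Longrightarrow> enumerate S 0 = (0::nat)"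
  by (simp add: enumerate_0 Least_equality)

lemma kseq_eq_digit_map:
  assumes "D \<subseteq> {0..<b}" "0 \<in> D" "2 \<le> card D"
  shows "kseq b D n = digit_map b (card D) (enumerate D) (n - 1)"
proof -
  interpret digit_substitution "card D" "enumerate D"
    by unfold_locales (use assms in \<open>simp_all add: enumerate_0_eq_0\<close>)
  have "finite D" using assms(1) finite_subset by blast
  then have bij: "bij_betw (enumerate D) {..<card D} D"
    and mono: "strict_mono_on {..<card D} (enumerate D)"
    by (auto intro!: strict_mono_onI finite_enumerate_mono finite_bij_enumerate)
  have "enumerate D r < b" if "r < card D" for r
    using bij_betwE[OF bij] assms(1) that by (meson atLeastLessThan_iff lessThan_iff subsetD)
  then have "strict_mono (digit_map b (card D) (enumerate D))"
    by (rule strict_mono_digit_map[OF mono])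
  then show ?thesis
    by (simp add: kseq_def enumerate_range_strict_mono flip: range_digit_map[OF bij])
qed

section \<open>Sums over blocks of digit strings\<close>

lemma sum_lessThan_mult:
  fixes f :: "nat \<Rightarrow> 'a::comm_monoid_add"
  shows "(\<Sum>n<H * k. f n) = (\<Sum>j<k. \<Sum>r<H. f (H * j + r))"
proof -
  have "sum f {j * H..<j * H + H} = (\<Sum>r<H. f (H * j + r))" for j
    using sum.shift_bounds_nat_ivl[of f 0 "j * H" H]
    by (simp add: add_ac mult.commute atLeast0LessThan)
  then show ?thesis
    using sum.nat_group[of f H k] by (simp add: mult.commute)
qed

locale digit_system = digit_substitution +
  fixes b :: nat
  assumes b_ge_2: "b \<ge> 2" and \<delta>_1: "\<delta> 1 \<noteq> 0"
begin

abbreviation \<kappa> :: "nat \<Rightarrow> nat" where "\<kappa> \<equiv> digit_map b q \<delta>"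

abbreviation \<sigma> :: "nat \<Rightarrow> nat" where "\<sigma> \<equiv> digit_map 1 q \<delta>"

text \<open>The sum runs over the \<open>q ^ m\<close> strings obtained by appending \<open>m\<close> low digits to a string with
  value \<open>u\<close> and digit sum \<open>v\<close>.\<close>

definition block_sum :: "(nat \<Rightarrow> nat \<Rightarrow> complex) \<Rightarrow> nat \<Rightarrow> nat \<Rightarrow> nat \<Rightarrow> complex" where
  "block_sum F m u v = (\<Sum>n<q ^ m. F (b ^ m * u + \<kappa> n) (v + \<sigma> n))"

definition decays :: "(nat \<Rightarrow> nat \<Rightarrow> complex) \<Rightarrow> bool" where
  "decays F \<longleftrightarrow> (\<forall>\<epsilon>>0. \<forall>\<^sub>F m in sequentially. \<forall>u v. norm (block_sum F m u v) \<le> \<epsilon> * real q ^ m)"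

lemma block_sum_digit_map:
  "block_sum F m (\<kappa> n) (\<sigma> n) = (\<Sum>r<q ^ m. F (\<kappa> (q ^ m * n + r)) (\<sigma> (q ^ m * n + r)))"
  unfolding block_sum_def by (intro sum.cong refl) (simp add: digit_map_concat)

lemma block_sum_concat:
  "block_sum F (m + k) u v = (\<Sum>n<q ^ k. block_sum F m (b ^ k * u + \<kappa> n) (v + \<sigma> n))"
  unfolding block_sum_def power_add sum_lessThan_mult
  by (intro sum.cong refl) (simp add: digit_map_concat distrib_left add.assoc mult.assoc)

lemma norm_block_sum_le:
  assumes "\<And>x y. norm (F x y) \<le> 1"
  shows "norm (block_sum F m u v) \<le> real q ^ m"
  unfolding block_sum_def
  using sum_norm_le[of "{..<q ^ m}" "\<lambda>n. F (b ^ m * u + \<kappa> n) (v + \<sigma> n)" "\<lambda>_. 1"] assms by simp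

lemma decaysI:
  assumes "\<And>\<epsilon>. \<epsilon> > 0 \<Longrightarrow> \<exists>m. \<forall>u v. norm (block_sum F m u v) \<le> \<epsilon> * real q ^ m"
  shows "decays F"
  unfolding decays_def
proof (intro allI impI)
  fix \<epsilon> :: real assume "\<epsilon> > 0"
  with assms obtain m where m: "\<And>u v. norm (block_sum F m u v) \<le> \<epsilon> * real q ^ m" by blast
  have "norm (block_sum F (m + k) u v) \<le> \<epsilon> * real q ^ (m + k)" for k u v
  proof -
    have "norm (block_sum F (m + k) u v) \<le> (\<Sum>n<q ^ k. \<epsilon> * real q ^ m)"
      unfolding block_sum_concat by (intro sum_norm_le m)
    then show ?thesis by (simp add: power_add mult_ac)
  qed
  then show "\<forall>\<^sub>F m in sequentially. \<forall>u v. norm (block_sum F m u v) \<le> \<epsilon> * real q ^ m"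
    unfolding eventually_sequentially by (metis le_Suc_ex)
qed

lemma decays_uniform:
  assumes "finite I" "\<And>i. i \<in> I \<Longrightarrow> decays (F i)" "\<epsilon> > 0"
  obtains m where "\<And>i u v. i \<in> I \<Longrightarrow> norm (block_sum (F i) m u v) \<le> \<epsilon> * real q ^ m"
proof -
  have "\<forall>\<^sub>F m in sequentially. \<forall>i\<in>I. \<forall>u v. norm (block_sum (F i) m u v) \<le> \<epsilon> * real q ^ m"
    using assms by (auto simp: decays_def intro: eventually_ball_finite)
  then obtain m where "\<forall>i\<in>I. \<forall>u v. norm (block_sum (F i) m u v) \<le> \<epsilon> * real q ^ m"
    by (auto simp: eventually_sequentially)
  then show thesis by (auto intro: that)
qed

lemma decays_linear_combination:
  assumes "finite I" "\<And>i. i \<in> I \<Longrightarrow> decays (F i)"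
  shows "decays (\<lambda>x y. \<Sum>i\<in>I. w i * F i x y)"
proof (rule decaysI)
  fix \<epsilon> :: real assume "\<epsilon> > 0"
  define total where "total = 1 + (\<Sum>i\<in>I. norm (w i))"
  have "total > 0" unfolding total_def by (intro add_pos_nonneg sum_nonneg) auto
  obtain m where m: "\<And>i u v. i \<in> I \<Longrightarrow> norm (block_sum (F i) m u v) \<le> \<epsilon> / total * real q ^ m"
    using decays_uniform[of I F "\<epsilon> / total"] assms \<open>\<epsilon> > 0\<close> \<open>total > 0\<close> by auto
  have "norm (block_sum (\<lambda>x y. \<Sum>i\<in>I. w i * F i x y) m u v) \<le> \<epsilon> * real q ^ m" for u v
  proof -
    have "block_sum (\<lambda>x y. \<Sum>i\<in>I. w i * F i x y) m u v = (\<Sum>i\<in>I. w i * block_sum (F i) m u v)"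
      unfolding block_sum_def sum_distrib_left by (rule sum.swap)
    also have "norm \<dots> \<le> (\<Sum>i\<in>I. norm (w i) * (\<epsilon> / total * real q ^ m))"
      by (rule sum_norm_le, unfold norm_mult) (intro mult_left_mono m norm_ge_zero)
    also have "\<dots> = (total - 1) * (\<epsilon> / total * real q ^ m)"
      by (simp only: total_def add_diff_cancel_left' sum_distrib_right)
    also have "\<dots> \<le> total * (\<epsilon> / total * real q ^ m)"
      using \<open>\<epsilon> > 0\<close> \<open>total > 0\<close> by (intro mult_right_mono) auto
    finally show ?thesis using \<open>total > 0\<close> by simp
  qed
  then show "\<exists>m. \<forall>u v. norm (block_sum (\<lambda>x y. \<Sum>i\<in>I. w i * F i x y) m u v) \<le> \<epsilon> * real q ^ m" by blast
qed

section \<open>Linear phases\<close>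

abbreviation linear_phase :: "real \<Rightarrow> real \<Rightarrow> real \<Rightarrow> nat \<Rightarrow> nat \<Rightarrow> complex" where
  "linear_phase A B C \<equiv> \<lambda>x y. ee (A * real x + B * real y + C)"

lemma block_sum_linear_phase_shift:
  "block_sum (linear_phase A B C) m (u + s) (v + t)
    = ee (A * real b ^ m * real s + B * real t) * block_sum (linear_phase A B C) m u v"
  unfolding block_sum_def sum_distrib_left ee_add[symmetric]
  by (intro sum.cong refl arg_cong[of _ _ ee]) (simp add: algebra_simps)

lemma norm_block_sum_linear_phase:
  "norm (block_sum (linear_phase A B C) m u v)
    = (\<Prod>j<m. norm (\<Sum>r<q. ee ((A * real b ^ j + B) * real (\<delta> r))))"
proof (induction m arbitrary: u v)
  case 0
  then show ?case by (simp add: block_sum_def)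
next
  case (Suc m)
  have "block_sum (linear_phase A B C) (m + 1) u v
      = (\<Sum>r<q. block_sum (linear_phase A B C) m (b * u + \<delta> r) (v + \<delta> r))"
    unfolding block_sum_concat by (intro sum.cong) (simp_all add: digit_map_digit)
  also have "\<dots> = (\<Sum>r<q. ee ((A * real b ^ m + B) * real (\<delta> r))) * block_sum (linear_phase A B C) m (b * u) v"
    unfolding block_sum_linear_phase_shift sum_distrib_right by (simp add: distrib_right)
  finally show ?case by (simp add: norm_mult Suc.IH)
qed

lemma decays_linear:
  assumes "A \<notin> \<rat> \<or> B \<notin> \<rat>"
  shows "decays (linear_phase A B C)"
proof (rule ccontr)
  define factor where "factor j = norm (\<Sum>r<q. ee ((A * real b ^ j + B) * real (\<delta> r))) / real q" for j
  have q_pos: "real q > 0" using q_ge_2 by simp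
  have "norm (\<Sum>r<q. ee ((A * real b ^ j + B) * real (\<delta> r))) \<le> real q" for j
    by (rule order.trans[OF norm_sum]) simp
  then have factor_le_1: "factor j \<le> 1" for j
    using q_pos by (simp add: factor_def)
  assume "\<not> decays (linear_phase A B C)"
  then obtain \<epsilon> where \<epsilon>: "\<epsilon> > 0" "\<And>m. \<exists>u v. \<epsilon> * real q ^ m < norm (block_sum (linear_phase A B C) m u v)"
    using decaysI[of "linear_phase A B C"] by (metis not_le)
  then have "\<epsilon> \<le> (\<Prod>j<m. factor j)" for m
    using \<epsilon>(2)[of m] q_pos
    by (simp add: norm_block_sum_linear_phase factor_def prod_dividef pos_le_divide_eq less_imp_le)
  then have "factor \<longlonglongrightarrow> 1"
    by (intro tendsto_1_of_prod_bounded_below[OF _ factor_le_1 \<epsilon>(1)]) (simp add: factor_def)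
  then have "(\<lambda>j. real q * factor j) \<longlonglongrightarrow> real q * 1"
    by (intro tendsto_intros)
  then have "(\<lambda>j. norm (\<Sum>r<q. ee ((A * real b ^ j + B) * real (\<delta> r)))) \<longlonglongrightarrow> real (card {..<q})"
    using q_pos by (simp add: factor_def)
  then have "(\<lambda>j. ee ((A * real b ^ j + B) * real (\<delta> 1)) - ee ((A * real b ^ j + B) * real (\<delta> 0))) \<longlonglongrightarrow> 0"
    by (intro diff_tendsto_0_of_norm_sum_tendsto_card[where I = "{..<q}"]) (use q_ge_2 in auto)
  then have "(\<lambda>j. ee ((A * real (\<delta> 1)) * real b ^ j + B * real (\<delta> 1))) \<longlonglongrightarrow> 1"
    by (simp add: \<delta>_0 LIM_zero_iff algebra_simps)
  from rational_of_ee_affine_power_tendsto_1[OF b_ge_2 this] show False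
    using assms \<delta>_1 by (simp add: Rats_mult_iff)
qed

section \<open>Coincidences of an integral linear form\<close>

definition digit_form :: "int \<Rightarrow> int \<Rightarrow> nat \<Rightarrow> int" where
  "digit_form a c r = a * int (\<kappa> r) + c * int (\<sigma> r)"

definition coincidences :: "int \<Rightarrow> int \<Rightarrow> nat \<Rightarrow> (nat \<times> nat) set" where
  "coincidences a c m = {(r, s) \<in> {..<q ^ m} \<times> {..<q ^ m}. digit_form a c r = digit_form a c s}"

definition form_phase :: "real \<Rightarrow> int \<Rightarrow> int \<Rightarrow> nat \<times> nat \<Rightarrow> nat \<Rightarrow> nat \<Rightarrow> complex" where
  "form_phase \<theta> a c = (\<lambda>(t, t').
    linear_phase ((real t - real t') * \<theta> * of_int a) ((real t - real t') * \<theta> * of_int c) 0)"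

lemma decays_form_phase:
  assumes "(a, c) \<noteq> (0, 0)" "\<theta> \<notin> \<rat>" "fst p \<noteq> snd p"
  shows "decays (form_phase \<theta> a c p)"
  unfolding form_phase_def case_prod_unfold
  using assms by (intro decays_linear) (auto simp: Rats_mult_iff)

lemma norm_block_sum_form_phase_le: "norm (block_sum (form_phase \<theta> a c p) m u v) \<le> real q ^ m"
  by (rule norm_block_sum_le) (simp add: form_phase_def case_prod_unfold)

lemma card_coincidences_le_block_sums:
  assumes "\<theta> \<noteq> 0"
  shows "(real T)\<^sup>2 * real (card (coincidences a c m))
    \<le> (\<Sum>p\<in>{..<T} \<times> {..<T}. (norm (block_sum (form_phase \<theta> a c p) m 0 0))\<^sup>2)"
proof -
  define g where "g r = \<theta> * of_int (digit_form a c r)" for r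
  have "{(r, s) \<in> {..<q ^ m} \<times> {..<q ^ m}. g r = g s} = coincidences a c m"
    using assms by (auto simp: g_def coincidences_def)
  moreover have "(\<Sum>r<q ^ m. ee ((real t - real t') * g r)) = block_sum (form_phase \<theta> a c (t, t')) m 0 0" for t t'
    by (simp add: block_sum_def form_phase_def g_def digit_form_def algebra_simps)
  ultimately show ?thesis
    using card_coincidences_le[of "{..<q ^ m}" T g] by (simp add: sum.cartesian_product case_prod_unfold)
qed

lemma coincidences_rare:
  assumes nonzero: "(a, c) \<noteq> (0, 0)" and \<epsilon>: "\<epsilon> > 0"
  obtains m where "real (card (coincidences a c m)) \<le> \<epsilon> * (real q ^ m)\<^sup>2"
proof -
  obtain \<theta> :: real where \<theta>: "\<theta> \<notin> \<rat>"
    using countable_rat uncountable_UNIV_real by (metis countable_subset subsetI)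
  then have "\<theta> \<noteq> 0" by auto
  obtain T :: nat where T: "real T > 2 / \<epsilon>" using reals_Archimedean2 by blast
  then have T_pos: "real T > 0" using \<epsilon> by (meson divide_pos_pos less_trans zero_less_numeral)
  let ?pairs = "{..<T} \<times> {..<T}" and ?diagonal = "(\<lambda>t. (t, t)) ` {..<T}"
  let ?S = "\<lambda>m p. block_sum (form_phase \<theta> a c p) m 0 0"
  have "finite (?pairs - ?diagonal)" by simp
  moreover have "decays (form_phase \<theta> a c p)" if "p \<in> ?pairs - ?diagonal" for p
    by (rule decays_form_phase[OF nonzero \<theta>]) (use that in auto)
  ultimately obtain m where off_diagonal: "\<And>p. p \<in> ?pairs - ?diagonal \<Longrightarrow> norm (?S m p) \<le> \<epsilon> / 2 * real q ^ m"
    by (rule decays_uniform[where F = "form_phase \<theta> a c", OF _ _ half_gt_zero[OF \<epsilon>]]) (assumption, rule that)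
  have "(real T)\<^sup>2 * real (card (coincidences a c m)) \<le> (\<Sum>p\<in>?pairs. (norm (?S m p))\<^sup>2)"
    by (rule card_coincidences_le_block_sums[OF \<open>\<theta> \<noteq> 0\<close>])
  also have "\<dots> \<le> 2 * (\<epsilon> / 2) * (real q ^ m)\<^sup>2 * real (card ?pairs)"
  proof (rule sum_le_of_rare_exceptions)
    have "real T * 1 \<le> real T * (\<epsilon> / 2 * real T)"
      using T \<epsilon> by (intro mult_left_mono) (simp_all add: field_simps)
    then show "real (card ?diagonal) \<le> \<epsilon> / 2 * real (card ?pairs)"
      by (simp add: card_image inj_on_def mult_ac)
    show "(norm (?S m p))\<^sup>2 \<le> \<epsilon> / 2 * (real q ^ m)\<^sup>2" if "p \<in> ?pairs - ?diagonal" for p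
      using mult_mono[OF off_diagonal[OF that] norm_block_sum_form_phase_le] \<epsilon>
      by (simp add: power2_eq_square mult_ac)
    show "(norm (?S m p))\<^sup>2 \<le> (real q ^ m)\<^sup>2" for p
      by (intro power_mono norm_block_sum_form_phase_le norm_ge_zero)
  qed (use \<epsilon> in auto)
  finally have "real (card (coincidences a c m)) \<le> \<epsilon> * (real q ^ m)\<^sup>2"
    using T_pos by (simp add: power2_eq_square mult_ac)
  then show thesis by (rule that)
qed

section \<open>Van der Corput differencing\<close>

definition digit_difference :: "(nat \<Rightarrow> nat \<Rightarrow> real) \<Rightarrow> nat \<Rightarrow> nat \<Rightarrow> nat \<Rightarrow> nat \<Rightarrow> nat \<Rightarrow> real" where
  "digit_difference P k r s x y = P (b ^ k * x + \<kappa> r) (y + \<sigma> r) - P (b ^ k * x + \<kappa> s) (y + \<sigma> s)"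

lemma van_der_Corput:
  "(norm (block_sum (\<lambda>x y. ee (P x y)) (k + m) u v))\<^sup>2
    \<le> real q ^ m * (\<Sum>r<q ^ k. \<Sum>s<q ^ k. norm (block_sum (\<lambda>x y. ee (digit_difference P k r s x y)) m u v))"
proof -
  define S where "S n = block_sum (\<lambda>x y. ee (P x y)) k (b ^ m * u + \<kappa> n) (v + \<sigma> n)" for n
  let ?D = "\<lambda>r s. block_sum (\<lambda>x y. ee (digit_difference P k r s x y)) m u v"
  have "complex_of_real (\<Sum>n<q ^ m. (norm (S n))\<^sup>2) = (\<Sum>n<q ^ m. \<Sum>r<q ^ k. \<Sum>s<q ^ k.
      ee (digit_difference P k r s (b ^ m * u + \<kappa> n) (v + \<sigma> n)))"
    by (simp add: S_def block_sum_def norm_sum_ee_squared digit_difference_def add.assoc del: of_real_power)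
  also have "\<dots> = (\<Sum>r<q ^ k. \<Sum>s<q ^ k. ?D r s)"
    unfolding block_sum_def by (subst sum.swap, rule sum.cong[OF refl], rule sum.swap)
  finally have expand: "complex_of_real (\<Sum>n<q ^ m. (norm (S n))\<^sup>2) = (\<Sum>r<q ^ k. \<Sum>s<q ^ k. ?D r s)" .
  have "(\<Sum>n<q ^ m. (norm (S n))\<^sup>2) = norm (complex_of_real (\<Sum>n<q ^ m. (norm (S n))\<^sup>2))"
    unfolding norm_of_real by (simp add: sum_nonneg)
  also have "\<dots> = norm (\<Sum>r<q ^ k. \<Sum>s<q ^ k. ?D r s)"
    unfolding expand ..
  also have "\<dots> \<le> (\<Sum>r<q ^ k. \<Sum>s<q ^ k. norm (?D r s))"
    by (intro sum_norm_le order_refl)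
  finally have sum_squares_le: "(\<Sum>n<q ^ m. (norm (S n))\<^sup>2) \<le> (\<Sum>r<q ^ k. \<Sum>s<q ^ k. norm (?D r s))" .
  have "(norm (block_sum (\<lambda>x y. ee (P x y)) (k + m) u v))\<^sup>2 \<le> (\<Sum>n<q ^ m. norm (S n))\<^sup>2"
    unfolding block_sum_concat S_def by (intro power_mono norm_sum) simp
  also have "\<dots> \<le> (\<Sum>n<q ^ m. (norm (S n))\<^sup>2) * real q ^ m"
    using sum_squared_le_sum_of_squares[of "\<lambda>n. norm (S n)" "{..<q ^ m}"] by simp
  also have "\<dots> \<le> real q ^ m * (\<Sum>r<q ^ k. \<Sum>s<q ^ k. norm (?D r s))"
    using mult_right_mono[OF sum_squares_le, of "real q ^ m"] by (simp add: mult.commute)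
  finally show ?thesis .
qed

lemma decays_of_digit_differences:
  assumes nonzero: "(a, c) \<noteq> (0, 0)"
    and diff: "\<And>k r s. digit_form a c r \<noteq> digit_form a c s \<Longrightarrow>
      decays (\<lambda>x y. ee (digit_difference P k r s x y))"
  shows "decays (\<lambda>x y. ee (P x y))"
proof (rule decaysI)
  fix \<epsilon> :: real assume \<epsilon>: "\<epsilon> > 0"
  obtain k where few_coincidences: "real (card (coincidences a c k)) \<le> \<epsilon>\<^sup>2 / 2 * (real q ^ k)\<^sup>2"
    by (rule coincidences_rare[OF nonzero, of "\<epsilon>\<^sup>2 / 2"]) (use \<epsilon> in simp)
  let ?pairs = "{..<q ^ k} \<times> {..<q ^ k}"
  let ?F = "\<lambda>(r, s) x y. ee (digit_difference P k r s x y)"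
  have "decays (?F p)" if "p \<in> ?pairs - coincidences a c k" for p
    using that diff by (auto simp: coincidences_def split: prod.splits)
  then obtain m where typical: "\<And>p u v. p \<in> ?pairs - coincidences a c k \<Longrightarrow>
      norm (block_sum (?F p) m u v) \<le> \<epsilon>\<^sup>2 / 2 * real q ^ m"
    using decays_uniform[of "?pairs - coincidences a c k" ?F "\<epsilon>\<^sup>2 / 2"] \<epsilon> by auto
  have "norm (block_sum (\<lambda>x y. ee (P x y)) (k + m) u v) \<le> \<epsilon> * real q ^ (k + m)" for u v
  proof -
    have "(\<Sum>p\<in>?pairs. norm (block_sum (?F p) m u v)) \<le> 2 * (\<epsilon>\<^sup>2 / 2) * real q ^ m * real (card ?pairs)"
    proof (rule sum_le_of_rare_exceptions[where B = "coincidences a c k"])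
      show "norm (block_sum (?F p) m u v) \<le> real q ^ m" for p
        by (rule norm_block_sum_le) (simp add: case_prod_unfold)
    qed (use few_coincidences typical in \<open>auto simp: coincidences_def power2_eq_square\<close>)
    then have "real q ^ m * (\<Sum>p\<in>?pairs. norm (block_sum (?F p) m u v))
        \<le> real q ^ m * (2 * (\<epsilon>\<^sup>2 / 2) * real q ^ m * real (card ?pairs))"
      by (rule mult_left_mono) simp
    also have "\<dots> = (\<epsilon> * real q ^ (k + m))\<^sup>2"
      by (simp add: power2_eq_square power_add)
    finally have "(norm (block_sum (\<lambda>x y. ee (P x y)) (k + m) u v))\<^sup>2 \<le> (\<epsilon> * real q ^ (k + m))\<^sup>2"
      using van_der_Corput[of P k m u v] by (simp add: sum.cartesian_product case_prod_unfold)
    then show ?thesis using \<epsilon> by (simp add: power2_le_iff_abs_le)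
  qed
  then show "\<exists>m. \<forall>u v. norm (block_sum (\<lambda>x y. ee (P x y)) m u v) \<le> \<epsilon> * real q ^ m" by blast
qed

end

section \<open>Differencing polynomials in two variables\<close>

text \<open>Degrees are integers so that the product rule and the difference rule hold without truncation; a negative
  degree forces the zero polynomial.\<close>

inductive bipoly_degree_le :: "int \<Rightarrow> (real \<Rightarrow> real \<Rightarrow> real) \<Rightarrow> bool" for d where
  zero: "bipoly_degree_le d (\<lambda>x y. 0)"
| monom: "int (i + j) \<le> d \<Longrightarrow> bipoly_degree_le d (\<lambda>x y. c * x ^ i * y ^ j)"
| add: "bipoly_degree_le d P \<Longrightarrow> bipoly_degree_le d Q \<Longrightarrow> bipoly_degree_le d (\<lambda>x y. P x y + Q x y)"

lemma bipoly_degree_le_mono: "bipoly_degree_le d P \<Longrightarrow> d \<le> e \<Longrightarrow> bipoly_degree_le e P"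
  by (induction rule: bipoly_degree_le.induct) (auto intro: bipoly_degree_le.intros)

lemma bipoly_degree_le_mult_monom:
  "bipoly_degree_le d P \<Longrightarrow> int (i + j) \<le> e \<Longrightarrow> bipoly_degree_le (d + e) (\<lambda>x y. P x y * (c * x ^ i * y ^ j))"
proof (induction rule: bipoly_degree_le.induct)
  case (monom i' j' c')
  then show ?case using bipoly_degree_le.monom[of "i' + i" "j' + j" "d + e" "c' * c"]
    by (simp add: mult_ac power_add)
qed (auto simp: distrib_right intro: bipoly_degree_le.intros)

lemma bipoly_degree_le_mult:
  assumes "bipoly_degree_le d P" "bipoly_degree_le e Q"
  shows "bipoly_degree_le (d + e) (\<lambda>x y. P x y * Q x y)"
  using assms(2,1)
  by (induction rule: bipoly_degree_le.induct)
    (auto simp: distrib_left intro: bipoly_degree_le.intros bipoly_degree_le_mult_monom)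

lemma bipoly_degree_le_const: "0 \<le> d \<Longrightarrow> bipoly_degree_le d (\<lambda>x y. c)"
  using bipoly_degree_le.monom[of 0 0 d c] by simp

lemma bipoly_degree_le_cmult: "bipoly_degree_le d P \<Longrightarrow> bipoly_degree_le d (\<lambda>x y. c * P x y)"
  using bipoly_degree_le_mult[OF bipoly_degree_le_const[of 0 c]] by simp

lemma bipoly_degree_le_diff:
  "bipoly_degree_le d P \<Longrightarrow> bipoly_degree_le d Q \<Longrightarrow> bipoly_degree_le d (\<lambda>x y. P x y - Q x y)"
  using bipoly_degree_le.add[OF _ bipoly_degree_le_cmult[of d Q "-1"], of P] by simp

lemma bipoly_degree_le_sum:
  "(\<And>i. i \<in> I \<Longrightarrow> bipoly_degree_le d (P i)) \<Longrightarrow> bipoly_degree_le d (\<lambda>x y. \<Sum>i\<in>I. P i x y)"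
  by (induction I rule: infinite_finite_induct) (auto intro: bipoly_degree_le.intros)

lemma bipoly_degree_le_power:
  assumes "bipoly_degree_le 1 u"
  shows "bipoly_degree_le (int n) (\<lambda>x y. u x y ^ n)"
proof (induction n)
  case 0
  then show ?case by (simp add: bipoly_degree_le_const)
next
  case (Suc n)
  from bipoly_degree_le_mult[OF assms this] show ?case by (simp add: add.commute)
qed

lemma bipoly_degree_le_0_imp_const: "bipoly_degree_le 0 P \<Longrightarrow> \<exists>c. P = (\<lambda>x y. c)"
proof (induction rule: bipoly_degree_le.induct)
  case (monom i j c)
  then have "i = 0" "j = 0" by simp_all
  then show ?case by (auto simp: fun_eq_iff)
qed (auto simp: fun_eq_iff)

lemma power_add_eq_first_order:
  fixes s :: "'a::comm_ring_1"
  shows "\<exists>c. \<forall>x. (x + s) ^ n = x ^ n + of_nat n * s * x ^ (n - 1) + (\<Sum>k<n - 1. c k * x ^ k)"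
proof (cases n)
  case (Suc m)
  have "(x + s) ^ n = x ^ n + of_nat n * s * x ^ (n - 1)
      + (\<Sum>k<n - 1. of_nat (n choose k) * s ^ (n - k) * x ^ k)" for x
    unfolding binomial_ring Suc
    by (simp add: lessThan_Suc_atMost[symmetric] mult_ac)
  then show ?thesis
    by (intro exI[of _ "\<lambda>k. of_nat (n choose k) * s ^ (n - k)"] allI)
qed simp

lemma bipoly_degree_le_power_derivative:
  assumes "bipoly_degree_le 1 u"
  shows "bipoly_degree_le (int n - 1) (\<lambda>x y. real n * s * u x y ^ (n - 1))"
proof (cases n)
  case (Suc m)
  then show ?thesis
    using bipoly_degree_le_cmult[OF bipoly_degree_le_power[OF assms, of m]] by simp
qed (simp add: bipoly_degree_le.zero)

lemma bipoly_degree_le_power_add_first_order: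
  assumes "bipoly_degree_le 1 u"
  shows "bipoly_degree_le (int n - 2) (\<lambda>x y. (u x y + s) ^ n - (u x y ^ n + real n * s * u x y ^ (n - 1)))"
proof -
  obtain c where c: "\<And>x. (x + s) ^ n = x ^ n + real n * s * x ^ (n - 1) + (\<Sum>k<n - 1. c k * x ^ k)"
    using power_add_eq_first_order[of s n] by blast
  have "bipoly_degree_le (int n - 2) (\<lambda>x y. \<Sum>k<n - 1. c k * u x y ^ k)"
    by (intro bipoly_degree_le_sum bipoly_degree_le_cmult
        bipoly_degree_le_mono[OF bipoly_degree_le_power[OF assms]]) auto
  then show ?thesis by (simp add: c)
qed

definition monom_differential ::
  "nat \<Rightarrow> nat \<Rightarrow> real \<Rightarrow> real \<Rightarrow> real \<Rightarrow> real \<Rightarrow> real" where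
  "monom_differential i j s t x y = real i * s * x ^ (i - 1) * y ^ j + real j * t * x ^ i * y ^ (j - 1)"

lemma bipoly_degree_le_monom_differential:
  assumes "bipoly_degree_le 1 u" "bipoly_degree_le 1 v"
  shows "bipoly_degree_le (int (i + j) - 1) (\<lambda>x y. monom_differential i j s t (u x y) (v x y))"
proof -
  have "bipoly_degree_le ((int i - 1) + int j) (\<lambda>x y. (real i * s * u x y ^ (i - 1)) * v x y ^ j)"
    "bipoly_degree_le (int i + (int j - 1)) (\<lambda>x y. u x y ^ i * (real j * t * v x y ^ (j - 1)))"
    by (intro bipoly_degree_le_mult bipoly_degree_le_power bipoly_degree_le_power_derivative assms)+
  then show ?thesis
    using bipoly_degree_le.add[of "int (i + j) - 1"] by (simp add: monom_differential_def algebra_simps)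
qed

lemma bipoly_degree_le_monom_add_first_order:
  assumes "bipoly_degree_le 1 u" "bipoly_degree_le 1 v"
  shows "bipoly_degree_le (int (i + j) - 2) (\<lambda>x y. (u x y + s) ^ i * (v x y + t) ^ j
    - (u x y ^ i * v x y ^ j + monom_differential i j s t (u x y) (v x y)))"
proof -
  define X X0 X1 where "X x y = (u x y + s) ^ i" and "X0 x y = u x y ^ i"
    and "X1 x y = real i * s * u x y ^ (i - 1)" for x y
  define Y Y0 Y1 where "Y x y = (v x y + t) ^ j" and "Y0 x y = v x y ^ j"
    and "Y1 x y = real j * t * v x y ^ (j - 1)" for x y
  have "bipoly_degree_le 1 (\<lambda>x y. v x y + t)"
    by (intro bipoly_degree_le.add bipoly_degree_le_const assms) simp
  then have Y: "bipoly_degree_le (int j) Y"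
    unfolding Y_def by (rule bipoly_degree_le_power)
  have X0: "bipoly_degree_le (int i) X0"
    unfolding X0_def by (rule bipoly_degree_le_power[OF assms(1)])
  have X1: "bipoly_degree_le (int i - 1) X1" and Y1: "bipoly_degree_le (int j - 1) Y1"
    unfolding X1_def Y1_def by (intro bipoly_degree_le_power_derivative assms)+
  have X_remainder: "bipoly_degree_le (int i - 2) (\<lambda>x y. X x y - (X0 x y + X1 x y))"
    and Y_remainder: "bipoly_degree_le (int j - 2) (\<lambda>x y. Y x y - (Y0 x y + Y1 x y))"
    unfolding X_def X0_def X1_def Y_def Y0_def Y1_def
    by (intro bipoly_degree_le_power_add_first_order assms)+
  have X0_plus_X1: "bipoly_degree_le (int i) (\<lambda>x y. X0 x y + X1 x y)"
    using X0 bipoly_degree_le_mono[OF X1] by (intro bipoly_degree_le.add) auto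
  have "bipoly_degree_le (int (i + j) - 2) (\<lambda>x y. (X x y - (X0 x y + X1 x y)) * Y x y
      + ((X0 x y + X1 x y) * (Y x y - (Y0 x y + Y1 x y)) + X1 x y * Y1 x y))"
    using bipoly_degree_le_mult[OF X_remainder Y] bipoly_degree_le_mult[OF X0_plus_X1 Y_remainder]
      bipoly_degree_le_mult[OF X1 Y1]
    by (intro bipoly_degree_le.add) (simp_all add: algebra_simps)
  moreover have "(X x y - (X0 x y + X1 x y)) * Y x y
      + ((X0 x y + X1 x y) * (Y x y - (Y0 x y + Y1 x y)) + X1 x y * Y1 x y)
    = X x y * Y x y - (X0 x y * Y0 x y + (X1 x y * Y0 x y + X0 x y * Y1 x y))" for x y
    by algebra
  ultimately show ?thesis
    by (simp add: X_def X0_def X1_def Y_def Y0_def Y1_def monom_differential_def mult_ac)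
qed

lemma bipoly_degree_le_linear_x: "bipoly_degree_le 1 (\<lambda>x y. \<beta> * x)"
  using bipoly_degree_le.monom[of 1 0 1 \<beta>] by simp

lemma bipoly_degree_le_linear_y: "bipoly_degree_le 1 (\<lambda>x y. y)"
  using bipoly_degree_le.monom[of 0 1 1 1] by simp

lemma bipoly_degree_le_monom_difference:
  "bipoly_degree_le (int (i + j) - 2) (\<lambda>x y. ((\<beta> * x + s) ^ i * (y + t) ^ j - (\<beta> * x + s') ^ i * (y + t') ^ j)
    - monom_differential i j (s - s') (t - t') (\<beta> * x) y)"
proof -
  note first_order = bipoly_degree_le_monom_add_first_order
    [OF bipoly_degree_le_linear_x bipoly_degree_le_linear_y, of i j \<beta>]
  show ?thesis
    using bipoly_degree_le_diff[OF first_order[of s t] first_order[of s' t']]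
    by (simp add: monom_differential_def algebra_simps)
qed

lemma bipoly_degree_le_difference:
  "bipoly_degree_le d L \<Longrightarrow>
    bipoly_degree_le (d - 1) (\<lambda>x y. L (\<beta> * x + s) (y + t) - L (\<beta> * x + s') (y + t'))"
proof (induction rule: bipoly_degree_le.induct)
  case zero
  then show ?case by (simp add: bipoly_degree_le.zero)
next
  case (monom i j c)
  let ?M = "\<lambda>x y. monom_differential i j (s - s') (t - t') (\<beta> * x) y"
  have "bipoly_degree_le (int (i + j) - 1)
      (\<lambda>x y. ((\<beta> * x + s) ^ i * (y + t) ^ j - (\<beta> * x + s') ^ i * (y + t') ^ j - ?M x y) + ?M x y)"
    by (intro bipoly_degree_le.add bipoly_degree_le_mono[OF bipoly_degree_le_monom_difference]
        bipoly_degree_le_monom_differential bipoly_degree_le_linear_x bipoly_degree_le_linear_y) simp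
  from bipoly_degree_le_mono[OF bipoly_degree_le_cmult[OF this, of c], of "d - 1"] show ?case
    using monom by (simp add: algebra_simps)
next
  case (add P Q)
  from bipoly_degree_le.add[OF add.IH] show ?case by (simp add: algebra_simps)
qed

definition hom_poly :: "nat \<Rightarrow> (nat \<Rightarrow> nat \<Rightarrow> real) \<Rightarrow> real \<Rightarrow> real \<Rightarrow> real" where
  "hom_poly d c x y = (\<Sum>i\<le>d. c i (d - i) * x ^ i * y ^ (d - i))"

text \<open>Coefficients of the differential of a form at \<open>(\<beta> x, y)\<close> in the direction \<open>(g, h)\<close>.\<close>

definition hom_differential ::
  "real \<Rightarrow> real \<Rightarrow> real \<Rightarrow> (nat \<Rightarrow> nat \<Rightarrow> real) \<Rightarrow> nat \<Rightarrow> nat \<Rightarrow> real" where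
  "hom_differential \<beta> g h c i j =
    \<beta> ^ i * (real (Suc i) * c (Suc i) j * g + real (Suc j) * c i (Suc j) * h)"

lemma hom_poly_hom_differential:
  "hom_poly d (hom_differential \<beta> g h c) x y
    = (\<Sum>i\<le>Suc d. c i (Suc d - i) * monom_differential i (Suc d - i) g h (\<beta> * x) y)"
proof -
  let ?x = "\<lambda>i. c i (Suc d - i) * (real i * g * (\<beta> * x) ^ (i - 1) * y ^ (Suc d - i))"
  let ?y = "\<lambda>i. c i (Suc d - i) * (real (Suc d - i) * h * (\<beta> * x) ^ i * y ^ (Suc d - i - 1))"
  have "(\<Sum>i\<le>Suc d. ?x i) = (\<Sum>i\<le>d. ?x (Suc i))"
    by (subst sum.atMost_Suc_shift) simp
  moreover have "(\<Sum>i\<le>Suc d. ?y i) = (\<Sum>i\<le>d. ?y i)"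
    by simp
  ultimately have "(\<Sum>i\<le>Suc d. ?x i + ?y i) = (\<Sum>i\<le>d. ?x (Suc i) + ?y i)"
    by (simp only: sum.distrib)
  also have "\<dots> = hom_poly d (hom_differential \<beta> g h c) x y"
    unfolding hom_poly_def hom_differential_def
    by (intro sum.cong refl) (simp add: Suc_diff_le algebra_simps)
  finally show ?thesis
    by (simp add: monom_differential_def distrib_left)
qed

lemma bipoly_degree_le_hom_difference:
  "bipoly_degree_le (int d - 1) (\<lambda>x y.
    (hom_poly (Suc d) c (\<beta> * x + s) (y + t) - hom_poly (Suc d) c (\<beta> * x + s') (y + t'))
      - hom_poly d (hom_differential \<beta> (s - s') (t - t') c) x y)"
proof -
  have "bipoly_degree_le (int d - 1) (\<lambda>x y. \<Sum>i\<le>Suc d. c i (Suc d - i)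
      * (((\<beta> * x + s) ^ i * (y + t) ^ (Suc d - i) - (\<beta> * x + s') ^ i * (y + t') ^ (Suc d - i))
        - monom_differential i (Suc d - i) (s - s') (t - t') (\<beta> * x) y))"
    by (intro bipoly_degree_le_sum bipoly_degree_le_cmult
        bipoly_degree_le_mono[OF bipoly_degree_le_monom_difference]) auto
  then show ?thesis
    unfolding hom_poly_hom_differential hom_poly_def[of "Suc d"]
    by (simp only: right_diff_distrib sum_subtractf mult.assoc)
qed

section \<open>Polynomials whose leading form is irrational\<close>

lemma rational_values_collinear:
  fixes \<alpha> \<beta> :: real
  assumes "\<alpha> \<notin> \<rat> \<or> \<beta> \<notin> \<rat>"
  obtains a c :: int where "(a, c) \<noteq> (0, 0)"
    "\<And>g h :: int. \<alpha> * of_int g + \<beta> * of_int h \<in> \<rat> \<Longrightarrow> a * g + c * h = 0"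
proof (cases "\<exists>g h :: int. (g, h) \<noteq> (0, 0) \<and> \<alpha> * of_int g + \<beta> * of_int h \<in> \<rat>")
  case True
  then obtain p r :: int where rational_value: "(p, r) \<noteq> (0, 0)" "\<alpha> * of_int p + \<beta> * of_int r \<in> \<rat>" by blast
  have "r * g + (- p) * h = 0" if rational: "\<alpha> * of_int g + \<beta> * of_int h \<in> \<rat>" for g h :: int
  proof (rule ccontr)
    define \<Delta> :: real where "\<Delta> = of_int (r * g + (- p) * h)"
    assume "r * g + (- p) * h \<noteq> 0"
    then have "\<Delta> \<in> \<rat> - {0}" unfolding \<Delta>_def of_int_eq_0_iff[symmetric, where 'a = real] by simp
    moreover have "\<alpha> * \<Delta> = (\<alpha> * of_int g + \<beta> * of_int h) * of_int r - (\<alpha> * of_int p + \<beta> * of_int r) * of_int h"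
      "\<beta> * \<Delta> = (\<alpha> * of_int p + \<beta> * of_int r) * of_int g - (\<alpha> * of_int g + \<beta> * of_int h) * of_int p"
      by (simp_all add: \<Delta>_def algebra_simps)
    then have "\<alpha> * \<Delta> \<in> \<rat>" "\<beta> * \<Delta> \<in> \<rat>"
      using rational rational_value(2) by (simp_all only: Rats_diff Rats_mult Rats_of_int)
    ultimately show False using assms by (simp add: Rats_mult_iff)
  qed
  then show thesis using rational_value(1) by (intro that[of r "- p"]) auto
next
  case False
  then show thesis by (intro that[of 0 1]) auto
qed

lemma irrational_hom_differential:
  assumes "i + j = Suc d" "c i j \<notin> \<rat>"
  obtains a e :: int and i' j' where "(a, e) \<noteq> (0, 0)" "i' + j' = d"
    "\<And>\<beta> g h. \<beta> \<in> \<rat> - {0} \<Longrightarrow> a * g + e * h \<noteq> 0 \<Longrightarrow> hom_differential \<beta> (of_int g) (of_int h) c i' j' \<notin> \<rat>"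
proof -
  define i' where "i' = i - 1"
  define j' where "j' = d - i'"
  have "i' + j' = d" using assms(1) by (auto simp: i'_def j'_def)
  have "i = Suc i' \<and> j = j' \<or> i = i' \<and> j = Suc j'" using assms(1) by (auto simp: i'_def j'_def)
  then have "real (Suc i') * c (Suc i') j' \<notin> \<rat> \<or> real (Suc j') * c i' (Suc j') \<notin> \<rat>"
    using assms(2) by (auto simp: Rats_mult_iff simp del: of_nat_Suc)
  then obtain a e :: int where line: "(a, e) \<noteq> (0, 0)" "\<And>g h :: int.
      real (Suc i') * c (Suc i') j' * of_int g + real (Suc j') * c i' (Suc j') * of_int h \<in> \<rat> \<Longrightarrow> a * g + e * h = 0"
    using rational_values_collinear by metis
  show thesis
    by (rule that[OF line(1) \<open>i' + j' = d\<close>])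
      (use line(2) in \<open>auto simp: hom_differential_def Rats_mult_iff simp del: of_nat_Suc\<close>)
qed

context digit_system
begin

abbreviation phase_decays :: "(real \<Rightarrow> real \<Rightarrow> real) \<Rightarrow> bool" where
  "phase_decays P \<equiv> decays (\<lambda>x y. ee (P (real x) (real y)))"

lemma phase_decays_of_irrational_leading_form:
  assumes "i + j = Suc d" "c i j \<notin> \<rat>"
    and "bipoly_degree_le (int d) (\<lambda>x y. P x y - hom_poly (Suc d) c x y)"
  shows "phase_decays P"
  using assms
proof (induction d arbitrary: c i j P)
  case 0
  then obtain C where "(\<lambda>x y. P x y - hom_poly 1 c x y) = (\<lambda>x y. C)"
    using bipoly_degree_le_0_imp_const by fastforce
  then have "P x y = c 1 0 * x + c 0 1 * y + C" for x y
    by (simp add: fun_eq_iff hom_poly_def diff_eq_eq add_ac)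
  moreover have "c 1 0 \<notin> \<rat> \<or> c 0 1 \<notin> \<rat>" using 0 by (cases i) auto
  ultimately show ?case using decays_linear by simp
next
  case (Suc d)
  obtain a e :: int and i' j' where form: "(a, e) \<noteq> (0, 0)" and degree: "i' + j' = Suc d"
    and irr: "\<And>\<beta> g h. \<beta> \<in> \<rat> - {0} \<Longrightarrow> a * g + e * h \<noteq> 0 \<Longrightarrow>
      hom_differential \<beta> (of_int g) (of_int h) c i' j' \<notin> \<rat>"
    using irrational_hom_differential[of i j "Suc d" c] Suc.prems(1,2) by metis
  show ?case
  proof (rule decays_of_digit_differences[OF form])
    fix k r s assume forms_differ: "digit_form a e r \<noteq> digit_form a e s"
    define \<beta> where "\<beta> = real b ^ k"
    define c' where "c' = hom_differential \<beta> (real (\<kappa> r) - real (\<kappa> s)) (real (\<sigma> r) - real (\<sigma> s)) c"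
    let ?\<Delta>P = "\<lambda>x y. P (\<beta> * x + real (\<kappa> r)) (y + real (\<sigma> r)) - P (\<beta> * x + real (\<kappa> s)) (y + real (\<sigma> s))"
    have lower: "bipoly_degree_le (int d) (\<lambda>x y. ?\<Delta>P x y - hom_poly (Suc d) c' x y)"
      using bipoly_degree_le.add[OF
          bipoly_degree_le_hom_difference[of "Suc d" c \<beta> "real (\<kappa> r)" "real (\<sigma> r)" "real (\<kappa> s)" "real (\<sigma> s)"]
          bipoly_degree_le_difference[OF Suc.prems(3), of \<beta> "real (\<kappa> r)" "real (\<sigma> r)" "real (\<kappa> s)" "real (\<sigma> s)"]]
      by (simp add: c'_def algebra_simps)
    have "\<beta> \<in> \<rat> - {0}" using b_ge_2 by (simp add: \<beta>_def)
    then have "c' i' j' \<notin> \<rat>"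
      using irr[of \<beta> "int (\<kappa> r) - int (\<kappa> s)" "int (\<sigma> r) - int (\<sigma> s)"] forms_differ
      by (simp add: c'_def digit_form_def algebra_simps)
    then have "phase_decays ?\<Delta>P"
      using Suc.IH[OF degree _ lower] by blast
    then show "decays (\<lambda>x y. ee (digit_difference (\<lambda>x y. P (real x) (real y)) k r s x y))"
      by (simp add: digit_difference_def \<beta>_def)
  qed
qed

end

section \<open>Polynomials with some irrational coefficient\<close>

lemma sum_ee_roots_of_unity:
  assumes "Q > 0"
  shows "(\<Sum>a<Q. ee (real a * (of_int n / real Q))) = (if int Q dvd n then of_nat Q else 0)"
proof -
  define \<omega> where "\<omega> = ee (of_int n / real Q)"
  have powers: "ee (real a * (of_int n / real Q)) = \<omega> ^ a" for a
    by (simp only: \<omega>_def ee_of_nat_mult)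
  have \<omega>_eq_1: "\<omega> = 1 \<longleftrightarrow> int Q dvd n"
    using of_int_div_of_int_in_Ints_iff[of n "int Q", where 'a = real] assms
    by (simp add: \<omega>_def ee_eq_1_iff)
  have "\<omega> ^ Q = 1"
    using assms by (simp add: \<omega>_def flip: ee_of_nat_mult)
  then show ?thesis
    unfolding powers using \<omega>_eq_1 by (auto simp: geometric_sum)
qed

definition fourier_coeff :: "nat \<Rightarrow> (nat \<Rightarrow> complex) \<Rightarrow> nat \<Rightarrow> complex" where
  "fourier_coeff Q f a = (\<Sum>r<Q. f r * ee (- (real a / real Q * real r))) / of_nat Q"

lemma fourier_expansion:
  assumes "Q > 0" and periodic: "\<And>x. f (x mod Q) = f x"
  shows "f x = (\<Sum>a<Q. fourier_coeff Q f a * ee (real a / real Q * real x))"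
proof -
  have "(\<Sum>a<Q. fourier_coeff Q f a * ee (real a / real Q * real x))
      = (\<Sum>a<Q. \<Sum>r<Q. f r * ee (real a * (of_int (int x - int r) / real Q))) / of_nat Q"
    unfolding fourier_coeff_def times_divide_eq_left sum_distrib_right sum_divide_distrib[symmetric]
      mult.assoc ee_add[symmetric]
    by (simp add: algebra_simps diff_divide_distrib)
  also have "\<dots> = (\<Sum>r<Q. f r * (\<Sum>a<Q. ee (real a * (of_int (int x - int r) / real Q)))) / of_nat Q"
    by (subst sum.swap) (simp only: sum_distrib_left)
  also have "\<dots> = (\<Sum>r<Q. if r = x mod Q then f r * of_nat Q else 0) / of_nat Q"
  proof (intro arg_cong2[of _ _ _ _ "(/)"] sum.cong refl)
    fix r assume "r \<in> {..<Q}"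
    then have "int Q dvd int x - int r \<longleftrightarrow> r = x mod Q"
      by (simp add: mod_eq_dvd_iff[symmetric] eq_commute flip: of_nat_mod)
    then show "f r * (\<Sum>a<Q. ee (real a * (of_int (int x - int r) / real Q)))
        = (if r = x mod Q then f r * of_nat Q else 0)"
      by (simp only: sum_ee_roots_of_unity[OF assms(1)]) simp
  qed
  also have "\<dots> = f x"
    using assms by simp
  finally show ?thesis ..
qed

lemma fourier_expansion_2:
  assumes "Q > 0" and periodic: "\<And>x y. f (x mod Q) (y mod Q) = f x y"
  obtains w where "\<And>x y. f x y
    = (\<Sum>(a, e)\<in>{..<Q} \<times> {..<Q}. w (a, e) * ee (real a / real Q * real x + real e / real Q * real y))"
proof -
  let ?w = "\<lambda>a y. fourier_coeff Q (\<lambda>x. f x y) a"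
  have periodic_x: "f (x mod Q) y = f x y" for x y
    using periodic[of "x mod Q" y] periodic[of x y] by simp
  have periodic_y: "(\<lambda>x. f x (y mod Q)) = (\<lambda>x. f x y)" for y
  proof (rule ext)
    show "f x (y mod Q) = f x y" for x
      using periodic[of x "y mod Q"] periodic[of x y] by simp
  qed
  have expansion_y: "?w a y = (\<Sum>e<Q. fourier_coeff Q (?w a) e * ee (real e / real Q * real y))" for a y
    by (rule fourier_expansion[of Q "?w a" y]) (simp_all only: assms(1) periodic_y)
  define w where "w = (\<lambda>(a, e). fourier_coeff Q (?w a) e)"
  have "f x y = (\<Sum>(a, e)\<in>{..<Q} \<times> {..<Q}. w (a, e) * ee (real a / real Q * real x + real e / real Q * real y))"
    for x y
  proof -
    have "f x y = (\<Sum>a<Q. ?w a y * ee (real a / real Q * real x))"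
      by (rule fourier_expansion[of Q "\<lambda>x. f x y"]) (simp_all only: assms(1) periodic_x)
    also have "\<dots> = (\<Sum>a<Q. (\<Sum>e<Q. w (a, e) * ee (real e / real Q * real y)) * ee (real a / real Q * real x))"
      unfolding w_def case_prod_conv expansion_y[symmetric] ..
    also have "\<dots> = (\<Sum>(a, e)\<in>{..<Q} \<times> {..<Q}. w (a, e) * ee (real a / real Q * real x + real e / real Q * real y))"
      by (simp add: sum_distrib_left sum_distrib_right ee_add mult_ac flip: sum.cartesian_product)
    finally show ?thesis .
  qed
  then show thesis by (rule that)
qed

lemma rational_common_denominator:
  fixes S :: "'a::field_char_0 set"
  assumes "finite S" "S \<subseteq> \<rat>"
  obtains Q :: nat where "Q > 0" "\<And>x. x \<in> S \<Longrightarrow> of_nat Q * x \<in> \<int>"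
proof -
  have "\<exists>Q :: nat. Q > 0 \<and> (\<forall>x\<in>S. of_nat Q * x \<in> \<int>)"
    using assms
  proof (induction S)
    case empty
    then show ?case by (intro exI[of _ 1]) simp
  next
    case (insert x S)
    then obtain Q :: nat where Q: "Q > 0" "\<forall>y\<in>S. of_nat Q * y \<in> \<int>" by auto
    from insert.prems obtain m n :: int where mn: "n > 0" "x = of_int m / of_int n"
      by (auto elim: Rats_cases')
    have "of_nat (Q * nat n) * x = of_int (int Q * m)"
      using mn by simp
    then have "of_nat (Q * nat n) * x \<in> \<int>" by (simp only: Ints_of_int)
    moreover have "of_nat (Q * nat n) * y \<in> \<int>" if "y \<in> S" for y
    proof -
      have "of_nat (Q * nat n) * y = of_nat (nat n) * (of_nat Q * y)" by (simp add: mult_ac)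
      then show ?thesis using Q(2) that by (simp only: Ints_mult Ints_of_nat)
    qed
    ultimately show ?case using Q(1) mn(1) by (intro exI[of _ "Q * nat n"]) auto
  qed
  then show thesis using that by blast
qed

lemma poly2_add: "poly2 d (\<lambda>i j. c i j + c' i j) x y = poly2 d c x y + poly2 d c' x y"
  by (simp add: poly2_def algebra_simps sum.distrib)

lemma poly2_cmult: "poly2 d (\<lambda>i j. k * c i j) x y = k * poly2 d c x y"
  by (simp add: poly2_def sum_distrib_left mult_ac)

lemma poly2_monom:
  assumes "i0 \<le> d" "j0 \<le> d"
  shows "poly2 d (\<lambda>i j. if i = i0 \<and> j = j0 then k else 0) x y = k * x ^ i0 * y ^ j0"
proof -
  have "(\<Sum>j\<le>d. (if i = i0 \<and> j = j0 then k else 0) * x ^ i * y ^ j)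
      = (\<Sum>j\<le>d. if j = j0 then (if i = i0 then k * x ^ i0 * y ^ j0 else 0) else 0)" for i
    by (intro sum.cong) auto
  then show ?thesis using assms by (simp add: poly2_def)
qed

lemma ee_poly2_periodic:
  assumes c: "\<And>i j. i \<le> d \<Longrightarrow> j \<le> d \<Longrightarrow> real Q * c i j \<in> \<int>"
  shows "ee (poly2 d c (real (x mod Q)) (real (y mod Q))) = ee (poly2 d c (real x) (real y))"
proof -
  have "c i j * real (x mod Q) ^ i * real (y mod Q) ^ j - c i j * real x ^ i * real y ^ j \<in> \<int>"
    if "i \<le> d" "j \<le> d" for i j
  proof -
    have "(int (x mod Q) ^ i * int (y mod Q) ^ j) mod int Q = (int x ^ i * int y ^ j) mod int Q"
      by (intro mod_mult_cong) (simp_all add: of_nat_mod power_mod)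
    then obtain k where "int (x mod Q) ^ i * int (y mod Q) ^ j - int x ^ i * int y ^ j = int Q * k"
      unfolding mod_eq_dvd_iff ..
    from arg_cong[OF this, of real_of_int]
    have k: "real (x mod Q) ^ i * real (y mod Q) ^ j - real x ^ i * real y ^ j = real Q * of_int k"
      by simp
    have "c i j * real (x mod Q) ^ i * real (y mod Q) ^ j - c i j * real x ^ i * real y ^ j
        = c i j * (real (x mod Q) ^ i * real (y mod Q) ^ j - real x ^ i * real y ^ j)"
      by (simp add: algebra_simps)
    also have "\<dots> = (real Q * c i j) * of_int k" unfolding k by simp
    finally show ?thesis using Ints_mult[OF c[OF that] Ints_of_int[of k]] by simp
  qed
  then show ?thesis
    unfolding ee_eq_iff poly2_def sum_subtractf[symmetric] by (intro Ints_sum) auto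
qed

lemma ee_rational_poly2_expansion:
  assumes "\<And>i j. i \<le> d \<Longrightarrow> j \<le> d \<Longrightarrow> c i j \<in> \<rat>"
  obtains Q w where "\<And>x y. ee (poly2 d c (real x) (real y))
    = (\<Sum>(a, e)\<in>{..<Q} \<times> {..<Q}. w (a, e) * ee (real a / real Q * real x + real e / real Q * real y))"
proof -
  define S where "S = (\<lambda>(i, j). c i j) ` ({..d} \<times> {..d})"
  have "S \<subseteq> \<rat>" using assms by (auto simp: S_def)
  then obtain Q :: nat where "Q > 0" and Q: "\<And>z. z \<in> S \<Longrightarrow> real Q * z \<in> \<int>"
    using rational_common_denominator[of S] by (auto simp: S_def)
  have "c i j \<in> S" if "i \<le> d" "j \<le> d" for i j
    using that by (auto simp: S_def intro: image_eqI[of _ _ "(i, j)"])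
  then have "ee (poly2 d c (real (x mod Q)) (real (y mod Q))) = ee (poly2 d c (real x) (real y))" for x y
    by (intro ee_poly2_periodic Q)
  then show thesis
    by (rule fourier_expansion_2[of Q "\<lambda>x y. ee (poly2 d c (real x) (real y))", OF \<open>Q > 0\<close>]) (rule that)
qed

lemma poly2_minus_leading_form_degree_le:
  assumes zero: "\<And>i j. i \<le> d \<Longrightarrow> j \<le> d \<Longrightarrow> i + j > e \<Longrightarrow> c i j = 0"
  shows "bipoly_degree_le (int e - 1)
    (\<lambda>x y. poly2 d c x y - hom_poly e (\<lambda>i j. if i \<le> d \<and> j \<le> d then c i j else 0) x y)"
proof -
  let ?lower = "\<lambda>x y. \<Sum>i\<le>d. \<Sum>j\<le>d. (if i + j < e then c i j else 0) * x ^ i * y ^ j"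
  have "hom_poly e (\<lambda>i j. if i \<le> d \<and> j \<le> d then c i j else 0) x y
      = (\<Sum>i\<le>d. \<Sum>j\<le>d. if i + j = e then c i j * x ^ i * y ^ j else 0)" for x y
  proof -
    have "(\<Sum>j\<le>d. if i + j = e then c i j * x ^ i * y ^ j else 0)
        = (if i \<le> e \<and> e - i \<le> d then c i (e - i) * x ^ i * y ^ (e - i) else 0)" for i
    proof (cases "i \<le> e")
      case True
      then have "i + j = e \<longleftrightarrow> j = e - i" for j by auto
      then show ?thesis using True by simp
    qed simp
    then show ?thesis
      unfolding hom_poly_def by simp (rule sum.mono_neutral_cong; auto)
  qed
  moreover have "poly2 d c x y = (\<Sum>i\<le>d. \<Sum>j\<le>d. if i + j = e then c i j * x ^ i * y ^ j else 0) + ?lower x y"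
    for x y
    unfolding poly2_def sum.distrib[symmetric]
    by (intro sum.cong refl) (use zero in \<open>auto simp: not_less\<close>)
  moreover have "bipoly_degree_le (int e - 1) ?lower"
  proof (intro bipoly_degree_le_sum)
    show "bipoly_degree_le (int e - 1) (\<lambda>x y. (if i + j < e then c i j else 0) * x ^ i * y ^ j)" for i j
      using bipoly_degree_le.monom[of i j "int e - 1"] bipoly_degree_le.zero by (cases "i + j < e") auto
  qed
  ultimately show ?thesis by simp
qed

definition irrational_part :: "(nat \<Rightarrow> nat \<Rightarrow> real) \<Rightarrow> nat \<Rightarrow> nat \<Rightarrow> real" where
  "irrational_part c i j = (if c i j \<in> \<rat> then 0 else c i j)"

lemma irrational_coeff_of_maximal_degree:
  assumes "has_irr_nonconst_coeff d c"
  obtains i0 j0 where "i0 \<le> d" "j0 \<le> d" "0 < i0 + j0" "c i0 j0 \<notin> \<rat>"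
    "\<And>i j. i \<le> d \<Longrightarrow> j \<le> d \<Longrightarrow> i0 + j0 < i + j \<Longrightarrow> c i j \<in> \<rat>"
proof -
  define degrees where "degrees = {i + j | i j. i \<le> d \<and> j \<le> d \<and> 0 < i + j \<and> c i j \<notin> \<rat>}"
  have "degrees \<subseteq> {..d + d}" by (auto simp: degrees_def)
  then have finite: "finite degrees" using finite_subset by blast
  moreover have "degrees \<noteq> {}" using assms by (auto simp: degrees_def has_irr_nonconst_coeff_def)
  ultimately have "Max degrees \<in> degrees" by (rule Max_in)
  then obtain i0 j0 where ij0: "i0 \<le> d" "j0 \<le> d" "0 < i0 + j0" "c i0 j0 \<notin> \<rat>" "Max degrees = i0 + j0"
    by (auto simp: degrees_def)
  show thesis
  proof (rule that[OF ij0(1-4)], rule ccontr)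
    fix i j assume "i \<le> d" "j \<le> d" "i0 + j0 < i + j" "c i j \<notin> \<rat>"
    then have "i + j \<in> degrees" unfolding degrees_def by fastforce
    then show False using Max_ge[OF finite] ij0(5) \<open>i0 + j0 < i + j\<close> by fastforce
  qed
qed

context digit_system
begin

lemma phase_decays_irrational_part_plus_linear:
  assumes "has_irr_nonconst_coeff d c" "A \<in> \<rat>" "B \<in> \<rat>"
  shows "phase_decays (\<lambda>x y. poly2 d (irrational_part c) x y + (A * x + B * y))"
proof -
  obtain i0 j0 where ij0: "i0 \<le> d" "j0 \<le> d" "0 < i0 + j0" "c i0 j0 \<notin> \<rat>"
    and max: "\<And>i j. i \<le> d \<Longrightarrow> j \<le> d \<Longrightarrow> i0 + j0 < i + j \<Longrightarrow> c i j \<in> \<rat>"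
    using irrational_coeff_of_maximal_degree[OF assms(1)] by metis
  obtain e where e: "i0 + j0 = Suc e" using ij0(3) gr0_implies_Suc by blast
  define l where "l = (\<lambda>(i::nat) (j::nat). (if i = 1 \<and> j = 0 then A else 0) + (if i = 0 \<and> j = 1 then B else 0))"
  define c' where "c' = (\<lambda>i j. irrational_part c i j + l i j)"
  have "d \<ge> 1" using ij0(1-3) by linarith
  then have "poly2 d l x y = A * x + B * y" for x y
    by (simp add: l_def poly2_add poly2_monom)
  then have c'_eq: "poly2 d (irrational_part c) x y + (A * x + B * y) = poly2 d c' x y" for x y
    unfolding c'_def poly2_add by simp
  have "l i0 j0 \<in> \<rat>" using assms by (simp add: l_def)
  then have "c' i0 j0 \<notin> \<rat>" using ij0(4) by (simp add: c'_def irrational_part_def Rats_add_iff)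
  moreover have "c' i j = 0" if "i \<le> d" "j \<le> d" "Suc e < i + j" for i j
    using max[of i j] that e by (auto simp: c'_def irrational_part_def l_def)
  ultimately show ?thesis
    unfolding c'_eq
    using phase_decays_of_irrational_leading_form
        [OF e, of "\<lambda>i j. if i \<le> d \<and> j \<le> d then c' i j else 0" "poly2 d c'"]
      poly2_minus_leading_form_degree_le[of d "Suc e" c'] ij0 by simp
qed

lemma phase_decays_poly2:
  assumes "has_irr_nonconst_coeff d c"
  shows "phase_decays (poly2 d c)"
proof -
  define rational_part where "rational_part i j = c i j - irrational_part c i j" for i j
  have "rational_part i j \<in> \<rat>" for i j by (simp add: rational_part_def irrational_part_def)
  then obtain Q w where expansion: "\<And>x y. ee (poly2 d rational_part (real x) (real y))
    = (\<Sum>(a, e)\<in>{..<Q} \<times> {..<Q}. w (a, e) * ee (real a / real Q * real x + real e / real Q * real y))"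
    by (rule ee_rational_poly2_expansion[of d rational_part]) (rule that)
  let ?P = "\<lambda>(a, e) x y. poly2 d (irrational_part c) x y + (real a / real Q * x + real e / real Q * y)"
  have "ee (poly2 d c (real x) (real y))
      = (\<Sum>p\<in>{..<Q} \<times> {..<Q}. w p * ee (?P p (real x) (real y)))" for x y
  proof -
    have "poly2 d c (real x) (real y)
        = poly2 d (irrational_part c) (real x) (real y) + poly2 d rational_part (real x) (real y)"
      unfolding poly2_add[symmetric] by (simp add: rational_part_def)
    then show ?thesis
      by (simp add: expansion ee_add sum_distrib_left case_prod_unfold mult_ac)
  qed
  moreover have "phase_decays (?P p)" for p
    unfolding case_prod_unfold
    by (intro phase_decays_irrational_part_plus_linear assms) auto
  ultimately show ?thesis
    using decays_linear_combination[of "{..<Q} \<times> {..<Q}" "\<lambda>p x y. ee (?P p (real x) (real y))" w] by simp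
qed

end

section \<open>Averages over long intervals\<close>

lemma norm_sum_incomplete_block_le:
  fixes f :: "nat \<Rightarrow> 'a::real_normed_vector"
  assumes "H > 0" and bounded: "\<And>n. norm (f n) \<le> 1"
  shows "norm ((\<Sum>i<n. f i) - (\<Sum>i<H * (n div H). f i)) \<le> real H"
proof -
  have "norm ((\<Sum>i<n. f i) - (\<Sum>i<H * (n div H). f i)) = norm (\<Sum>i\<in>{H * (n div H)..<n}. f i)"
    using sum_diff_nat_ivl[of 0 "H * (n div H)" n f] by (simp add: atLeast0LessThan)
  also have "\<dots> \<le> (\<Sum>i\<in>{H * (n div H)..<n}. 1)"
    by (rule sum_norm_le) (rule bounded)
  also have "\<dots> = real (n mod H)" by (simp add: minus_mult_div_eq_mod del: of_nat_diff)
  also have "\<dots> \<le> real H" using \<open>H > 0\<close> by (simp add: less_imp_le)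
  finally show ?thesis .
qed

lemma norm_sum_le_of_block_bound:
  fixes f :: "nat \<Rightarrow> 'a::real_normed_vector"
  assumes "H > 0" and bounded: "\<And>n. norm (f n) \<le> 1" and "\<epsilon> \<ge> 0" and "M \<le> N"
    and block: "\<And>k. norm (\<Sum>r<H. f (H * k + r)) \<le> \<epsilon> * real H"
  shows "norm (\<Sum>n\<in>{M..<N}. f n) \<le> \<epsilon> * real (N - M) + (2 + \<epsilon>) * real H"
proof -
  define A B where "A = M div H" and "B = N div H"
  define S where "S n = (\<Sum>i<n. f i)" for n
  have incomplete_block: "norm (S n - S (H * (n div H))) \<le> real H" for n
    unfolding S_def by (rule norm_sum_incomplete_block_le[OF \<open>H > 0\<close> bounded])
  have "S (H * B) - S (H * A) = (\<Sum>j\<in>{A..<B}. \<Sum>r<H. f (H * j + r))"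
    using sum_diff_nat_ivl[of 0 A B "\<lambda>j. \<Sum>r<H. f (H * j + r)"] div_le_mono[OF \<open>M \<le> N\<close>, of H]
    by (simp add: S_def A_def B_def sum_lessThan_mult atLeast0LessThan)
  then have "norm (S (H * B) - S (H * A)) \<le> (\<Sum>j\<in>{A..<B}. \<epsilon> * real H)"
    by (simp only:) (intro sum_norm_le block)
  also have "\<dots> = \<epsilon> * real (H * B - H * A)"
    by (simp add: diff_mult_distrib2[symmetric] del: of_nat_diff)
  also have "\<dots> \<le> \<epsilon> * real (N - M + H)"
  proof (intro mult_left_mono \<open>\<epsilon> \<ge> 0\<close>)
    have "H * B \<le> N" by (simp add: B_def)
    moreover have "M \<le> H * A + H"
      using mod_less_divisor[OF \<open>H > 0\<close>, of M] mult_div_mod_eq[of H M] unfolding A_def by linarith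
    ultimately show "real (H * B - H * A) \<le> real (N - M + H)" by simp
  qed
  finally have complete_blocks: "norm (S (H * B) - S (H * A)) \<le> \<epsilon> * real (N - M) + \<epsilon> * real H"
    by (simp add: algebra_simps)
  have "(\<Sum>n\<in>{M..<N}. f n) = (S N - S (H * B)) + (S (H * B) - S (H * A)) - (S M - S (H * A))"
    using sum_diff_nat_ivl[of 0 M N f] \<open>M \<le> N\<close> by (simp add: S_def atLeast0LessThan)
  also have "norm \<dots> \<le> norm (S N - S (H * B)) + norm (S (H * B) - S (H * A)) + norm (S M - S (H * A))"
    by (intro norm_triangle_le_diff norm_triangle_le order_refl add_mono)
  also have "\<dots> \<le> real H + (\<epsilon> * real (N - M) + \<epsilon> * real H) + real H"
    using incomplete_block complete_blocks unfolding A_def B_def by (intro add_mono)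
  finally show ?thesis by (simp add: algebra_simps)
qed

lemma avg_tends_zero_of_block_bounds:
  assumes bounded: "\<And>n. norm (f n) \<le> 1"
    and block: "\<And>\<epsilon>. \<epsilon> > 0 \<Longrightarrow> \<exists>H>0. \<forall>k. norm (\<Sum>r<H. f (H * k + r)) \<le> \<epsilon> * real H"
  shows "avg_tends_zero (\<lambda>n. f (n - 1))"
  unfolding avg_tends_zero_def
proof (intro allI impI)
  fix \<eta> :: real assume \<eta>: "\<eta> > 0"
  obtain H where H: "H > 0" "\<And>k. norm (\<Sum>r<H. f (H * k + r)) \<le> \<eta> / 2 * real H"
    using block[of "\<eta> / 2"] \<eta> by auto
  obtain L :: nat where L: "real L > (2 + \<eta> / 2) * real H / (\<eta> / 2)" using reals_Archimedean2 by blast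
  have "norm ((\<Sum>n\<in>{M<..N}. f (n - 1)) / of_nat (N - M)) < \<eta>" if MN: "M < N" "N - M \<ge> L" for M N
  proof -
    have "(\<Sum>n\<in>{M<..N}. f (n - 1)) = (\<Sum>n\<in>{M..<N}. f n)"
      by (rule sum.reindex_bij_witness[of _ Suc "\<lambda>n. n - 1"]) auto
    then have "norm (\<Sum>n\<in>{M<..N}. f (n - 1)) \<le> \<eta> / 2 * real (N - M) + (2 + \<eta> / 2) * real H"
      using norm_sum_le_of_block_bound[OF H(1) bounded _ _ H(2), of M N] \<eta> MN by simp
    moreover have "(2 + \<eta> / 2) * real H < \<eta> / 2 * real L" using L \<eta> by (simp add: field_simps)
    moreover have "\<eta> / 2 * real L \<le> \<eta> / 2 * real (N - M)" using MN \<eta> by (intro mult_left_mono) auto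
    ultimately have "norm (\<Sum>n\<in>{M<..N}. f (n - 1)) < \<eta> * real (N - M)" by simp
    then show ?thesis using MN by (simp add: norm_divide divide_less_eq del: of_nat_diff)
  qed
  then show "\<exists>L. \<forall>M N. M < N \<and> N - M \<ge> L \<longrightarrow> norm ((\<Sum>n\<in>{M<..N}. f (n - 1)) / of_nat (N - M)) < \<eta>"
    by blast
qed

lemma avg_tends_zero_imp_mean_tendsto_0:
  assumes "avg_tends_zero f"
  shows "(\<lambda>N. (\<Sum>n\<in>{1..N}. f n) / of_nat N) \<longlonglongrightarrow> 0"
proof (rule LIMSEQ_I)
  fix e :: real assume "e > 0"
  with assms obtain L where L: "\<And>M N. M < N \<Longrightarrow> N - M \<ge> L \<Longrightarrow>
      norm ((\<Sum>n\<in>{M<..N}. f n) / of_nat (N - M)) < e"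
    unfolding avg_tends_zero_def by blast
  have "norm ((\<Sum>n\<in>{1..N}. f n) / of_nat N - 0) < e" if "N \<ge> Suc L" for N
  proof -
    have "{0<..N} = {1..N}" by auto
    then show ?thesis using L[of 0 N] that by simp
  qed
  then show "\<exists>no. \<forall>N\<ge>no. norm ((\<Sum>n\<in>{1..N}. f n) / of_nat N - 0) < e" by blast
qed

lemma (in digit_system) decays_imp_avg_tends_zero:
  assumes "decays F" and bounded: "\<And>x y. norm (F x y) \<le> 1"
  shows "avg_tends_zero (\<lambda>n. F (\<kappa> (n - 1)) (\<sigma> (n - 1)))"
proof (rule avg_tends_zero_of_block_bounds[where f = "\<lambda>n. F (\<kappa> n) (\<sigma> n)"])
  fix \<epsilon> :: real assume "\<epsilon> > 0"
  with assms(1) obtain m where "\<And>u v. norm (block_sum F m u v) \<le> \<epsilon> * real q ^ m"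
    unfolding decays_def eventually_sequentially by blast
  then have "norm (\<Sum>r<q ^ m. F (\<kappa> (q ^ m * k + r)) (\<sigma> (q ^ m * k + r))) \<le> \<epsilon> * real (q ^ m)" for k
    unfolding block_sum_digit_map[symmetric] by (simp only: of_nat_power)
  then show "\<exists>H>0. \<forall>k. norm (\<Sum>r<H. F (\<kappa> (H * k + r)) (\<sigma> (H * k + r))) \<le> \<epsilon> * real H"
    using q_ge_2 by (intro exI[of _ "q ^ m"]) auto
qed (rule bounded)

lemma avg_tends_zero_kseq:
  assumes "b \<ge> 2" and D: "D \<subseteq> {0..<b}" "0 \<in> D" "2 \<le> card D"
    and irr: "has_irr_nonconst_coeff d c"
  shows "avg_tends_zero (\<lambda>n. ee (poly2 d c (real (kseq b D n)) (real (digsum b (kseq b D n)))))"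
proof -
  have "finite D" using D(1) finite_subset by blast
  then have digit_less: "enumerate D r < b" if "r < card D" for r
    using finite_enumerate_in_set[of D r] D(1) that by auto
  have "enumerate D 0 < enumerate D 1"
    using \<open>finite D\<close> D(3) by (intro finite_enumerate_mono) auto
  then interpret digit_system "card D" "enumerate D" b
    using assms by unfold_locales (auto simp: enumerate_0_eq_0)
  have "kseq b D n = \<kappa> (n - 1)" "digsum b (kseq b D n) = \<sigma> (n - 1)" for n
    by (simp_all only: kseq_eq_digit_map[OF D] digsum_digit_map[OF \<open>b \<ge> 2\<close> digit_less])
  then show ?thesis
    using decays_imp_avg_tends_zero[OF phase_decays_poly2[OF irr]] by simp
qed

section \<open>Trigonometric polynomials\<close>

inductive trig_poly :: "(real \<Rightarrow> complex) \<Rightarrow> bool" where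
  char: "trig_poly (\<lambda>x. c * ee (of_int k * x))"
| add: "trig_poly f \<Longrightarrow> trig_poly g \<Longrightarrow> trig_poly (\<lambda>x. f x + g x)"

lemma trig_poly_const: "trig_poly (\<lambda>x. c)"
  using trig_poly.char[of c 0] by simp

lemma trig_poly_mult_char: "trig_poly f \<Longrightarrow> trig_poly (\<lambda>x. f x * (c * ee (of_int k * x)))"
proof (induction rule: trig_poly.induct)
  case (char c' k')
  have "(\<lambda>x. c' * ee (of_int k' * x) * (c * ee (of_int k * x))) = (\<lambda>x. (c' * c) * ee (of_int (k' + k) * x))"
    by (simp add: ring_distribs ee_add mult_ac)
  with trig_poly.char[of "c' * c" "k' + k"] show ?case by (simp only:)
qed (auto simp: distrib_right intro: trig_poly.intros)

lemma trig_poly_mult: "trig_poly g \<Longrightarrow> trig_poly f \<Longrightarrow> trig_poly (\<lambda>x. f x * g x)"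
  by (induction rule: trig_poly.induct) (auto simp: distrib_left intro: trig_poly.intros trig_poly_mult_char)

lemma trig_poly_diff: "trig_poly f \<Longrightarrow> trig_poly g \<Longrightarrow> trig_poly (\<lambda>x. f x - g x)"
  using trig_poly.add[OF _ trig_poly_mult[OF trig_poly_const[of "-1"]], of f g] by simp

lemma trig_poly_continuous_on: "trig_poly f \<Longrightarrow> continuous_on S f"
  by (induction rule: trig_poly.induct) (auto intro!: continuous_intros)

lemma trig_poly_integrable: "trig_poly f \<Longrightarrow> f integrable_on {0..1}"
  by (intro integrable_continuous_interval trig_poly_continuous_on)

lemma trig_poly_real_polynomial_of_ee:
  fixes g :: "complex \<Rightarrow> real"
  shows "real_polynomial_function g \<Longrightarrow> trig_poly (\<lambda>x. complex_of_real (g (ee x)))"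
proof (induction rule: real_polynomial_function.induct)
  case (linear f)
  then interpret f: bounded_linear f .
  have f_eq: "f z = Re z * f 1 + Im z * f \<i>" for z
  proof -
    have "z = Re z *\<^sub>R 1 + Im z *\<^sub>R \<i>" by (simp add: complex_eq_iff)
    then have "f z = f (Re z *\<^sub>R 1 + Im z *\<^sub>R \<i>)" by simp
    then show ?thesis by (simp add: f.add f.scaleR)
  qed
  define A B where "A = (of_real (f 1) - \<i> * of_real (f \<i>)) / 2"
    and "B = (of_real (f 1) + \<i> * of_real (f \<i>)) / 2"
  have "complex_of_real (f z) = A * z + B * cnj z" for z
    by (subst f_eq) (simp add: A_def B_def complex_eq_iff field_simps)
  then have "(\<lambda>x. complex_of_real (f (ee x))) = (\<lambda>x. A * ee (of_int 1 * x) + B * ee (of_int (- 1) * x))"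
    by (simp add: ee_minus)
  with trig_poly.add[OF trig_poly.char[of A 1] trig_poly.char[of B "- 1"]] show ?case by (simp only:)
qed (auto intro: trig_poly_const trig_poly.add trig_poly_mult)

lemma integral_char: "integral {0..1} (\<lambda>x. c * ee (of_int k * x)) = (if k = 0 then c else 0)"
proof (cases "k = 0")
  case False
  define w where "w = 2 * of_real pi * \<i> * of_int k"
  have w: "w \<noteq> 0" using False by (simp add: w_def)
  have ee_w: "ee (of_int k * x) = exp (w * of_real x)" for x
    by (simp add: ee_def w_def mult_ac)
  have "((\<lambda>x. exp (w * of_real x)) has_integral (exp (w * of_real 1) / w - exp (w * of_real 0) / w)) {0..1}"
  proof (rule fundamental_theorem_of_calculus)
    fix x :: real
    have "((\<lambda>z. exp (w * z) / w) has_field_derivative exp (w * of_real x)) (at (of_real x))"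
      using w by (auto intro!: derivative_eq_intros)
    then show "((\<lambda>x. exp (w * of_real x) / w) has_vector_derivative exp (w * of_real x)) (at x within {0..1})"
      by (rule has_vector_derivative_real_field)
  qed simp
  moreover have "exp (w * of_real 1) = 1" using ee_of_int[of k] ee_w[of 1] by simp
  ultimately have "((\<lambda>x. ee (of_int k * x)) has_integral 0) {0..1}" by (simp add: ee_w)
  from integral_unique[OF has_integral_mult_right[OF this, of c]] show ?thesis using False by simp
qed simp

definition real_trig_poly :: "(real \<Rightarrow> real) \<Rightarrow> bool" where
  "real_trig_poly f \<longleftrightarrow> trig_poly (\<lambda>x. complex_of_real (f x))"

lemma real_trig_poly_const: "real_trig_poly (\<lambda>x. c)"
  unfolding real_trig_poly_def by (rule trig_poly_const)

lemma real_trig_poly_diff: "real_trig_poly f \<Longrightarrow> real_trig_poly g \<Longrightarrow> real_trig_poly (\<lambda>x. f x - g x)"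
  unfolding real_trig_poly_def by (simp add: trig_poly_diff)

lemma real_trig_poly_integrable:
  assumes "real_trig_poly f"
  shows "f integrable_on {0..1}"
proof -
  have "continuous_on {0..1} (\<lambda>x. Re (complex_of_real (f x)))"
    using assms unfolding real_trig_poly_def by (intro continuous_intros trig_poly_continuous_on)
  then show ?thesis by (intro integrable_continuous_interval) simp
qed

lemma integral_one_minus_real_trig_poly:
  assumes "real_trig_poly f"
  shows "integral {0..1} (\<lambda>x. 1 - f x) = 1 - integral {0..1} f"
  using assms
  by (simp add: Henstock_Kurzweil_Integration.integral_diff real_trig_poly_integrable real_trig_poly_const)

lemma real_trig_poly_approximation:
  fixes h :: "complex \<Rightarrow> real"
  assumes "continuous_on (sphere 0 1) h" "\<eta> > 0"
  obtains f where "real_trig_poly f" "\<And>x. \<bar>h (ee x) - f x\<bar> < \<eta>"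
proof -
  obtain g where g: "real_polynomial_function g" "\<And>z. z \<in> sphere 0 1 \<Longrightarrow> \<bar>h z - g z\<bar> < \<eta>"
    using Stone_Weierstrass_real_polynomial_function[OF compact_sphere assms] by blast
  show thesis
  proof
    show "real_trig_poly (\<lambda>x. g (ee x))"
      unfolding real_trig_poly_def by (rule trig_poly_real_polynomial_of_ee[OF g(1)])
    show "\<bar>h (ee x) - g (ee x)\<bar> < \<eta>" for x by (rule g(2)) simp
  qed
qed

lemma continuous_bump_on_circle:
  assumes "0 \<le> a" "b \<le> 1" "\<eta> > 0"
  obtains h :: "complex \<Rightarrow> real" where "continuous_on UNIV h"
    "\<And>x. indicat_real {a + \<eta>..b - \<eta>} x \<le> h (ee x)" "\<And>x. h (ee x) \<le> indicat_real {a<..<b} (frac x)"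
proof -
  define outer inner where "outer = ee ` ({0..a} \<union> {b..1})" and "inner = ee ` {a + \<eta>..b - \<eta>}"
  have closed: "closed outer" "closed inner"
    unfolding outer_def inner_def
    by (intro compact_imp_closed compact_continuous_image continuous_intros compact_Un compact_Icc)+
  have "outer \<inter> inner = {}"
  proof (rule ccontr)
    assume "outer \<inter> inner \<noteq> {}"
    then obtain s t where st: "s \<in> {0..a} \<union> {b..1}" "t \<in> {a + \<eta>..b - \<eta>}" "ee s = ee t"
      unfolding outer_def inner_def by blast
    then obtain k :: int where k: "s - t = of_int k" unfolding ee_eq_iff by (auto elim: Ints_cases)
    have "\<bar>s - t\<bar> < 1" using st(1,2) assms by auto
    then have "k = 0" unfolding k by linarith
    then show False using k st(1,2) assms(3) by auto
  qed
  then obtain h :: "complex \<Rightarrow> real" where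
    h: "continuous_on UNIV h" "\<And>z. h z \<in> closed_segment 0 1"
      "\<And>z. z \<in> outer \<Longrightarrow> h z = 0" "\<And>z. z \<in> inner \<Longrightarrow> h z = 1"
    by (rule Urysohn[OF closed]) (rule that)
  show thesis
  proof
    have h_bounds: "0 \<le> h z" "h z \<le> 1" for z using h(2)[of z] by (auto simp: closed_segment_eq_real_ivl)
    show "indicat_real {a + \<eta>..b - \<eta>} x \<le> h (ee x)" for x
      using h(4)[of "ee x"] h_bounds(1)[of "ee x"] by (auto simp: indicator_def inner_def)
    show "h (ee x) \<le> indicat_real {a<..<b} (frac x)" for x
    proof (cases "frac x \<in> {a<..<b}")
      case False
      then have "frac x \<in> {0..a} \<union> {b..1}" using frac_ge_0[of x] frac_lt_1[of x] by auto
      then have "ee (frac x) \<in> outer" unfolding outer_def by (rule imageI)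
      then show ?thesis by (simp add: ee_frac h(3))
    qed (simp add: h_bounds)
  qed (rule h(1))
qed

lemma real_trig_poly_minorant:
  assumes ab: "0 \<le> a" "b \<le> 1" and \<epsilon>: "\<epsilon> > 0"
  obtains f where "real_trig_poly f" "\<And>x. f x \<le> indicat_real {a<..<b} (frac x)"
    "b - a - \<epsilon> \<le> integral {0..1} f"
proof -
  define \<eta> where "\<eta> = \<epsilon> / 4"
  have "\<eta> > 0" using \<epsilon> by (simp add: \<eta>_def)
  obtain h where h: "continuous_on UNIV h" "\<And>x. indicat_real {a + \<eta>..b - \<eta>} x \<le> h (ee x)"
    "\<And>x. h (ee x) \<le> indicat_real {a<..<b} (frac x)"
    by (rule continuous_bump_on_circle[OF ab \<open>\<eta> > 0\<close>]) (rule that)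
  have "continuous_on (sphere 0 1) h" using h(1) continuous_on_subset by blast
  then obtain g where g: "real_trig_poly g" "\<And>x. \<bar>h (ee x) - g x\<bar> < \<eta>"
    by (rule real_trig_poly_approximation[OF _ \<open>\<eta> > 0\<close>]) (rule that)
  let ?f = "\<lambda>x. g x - \<eta>"
  show thesis
  proof
    show f: "real_trig_poly ?f" by (intro real_trig_poly_diff real_trig_poly_const g)
    show "?f x \<le> indicat_real {a<..<b} (frac x)" for x
      using g(2)[of x] h(3)[of x] by linarith
    let ?I = "{a + \<eta>..b - \<eta>}"
    have I_eq: "indicat_real ?I = (\<lambda>x. if x \<in> ?I then 1 else 0)" by (auto simp: indicator_def)
    have I_sub: "?I \<subseteq> {0..1}" using ab \<open>\<eta> > 0\<close> by auto
    have "(indicat_real ?I has_integral measure lborel ?I) {0..1}"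
      unfolding I_eq has_integral_restrict[OF I_sub]
      using has_integral_const_real[of "1::real" "a + \<eta>" "b - \<eta>"] by simp
    moreover have "((\<lambda>x. 2 * \<eta>) has_integral (2 * \<eta>)) {0..1::real}"
      using has_integral_const_real[of "2 * \<eta>" 0 1] by simp
    ultimately have "((\<lambda>x. indicat_real ?I x - 2 * \<eta>) has_integral measure lborel ?I - 2 * \<eta>) {0..1}"
      by (rule has_integral_diff)
    then have "measure lborel ?I - 2 * \<eta> \<le> integral {0..1} ?f"
    proof (rule has_integral_le[OF _ integrable_integral[OF real_trig_poly_integrable[OF f]]])
      show "indicat_real ?I x - 2 * \<eta> \<le> ?f x" for x
        using g(2)[of x] h(2)[of x] by linarith
    qed
    moreover have "(b - \<eta>) - (a + \<eta>) \<le> measure lborel ?I" by (simp add: content_real_if)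
    ultimately show "b - a - \<epsilon> \<le> integral {0..1} ?f" by (simp add: \<eta>_def)
  qed
qed

lemma real_trig_poly_majorant:
  assumes ab: "0 \<le> a" "a < b" "b \<le> 1" and \<epsilon>: "\<epsilon> > 0"
  obtains f where "real_trig_poly f" "\<And>x. indicat_real {a<..<b} (frac x) \<le> f x"
    "integral {0..1} f \<le> b - a + \<epsilon>"
proof -
  obtain f1 where f1: "real_trig_poly f1" "\<And>x. f1 x \<le> indicat_real {0<..<a} (frac x)"
      "a - 0 - \<epsilon> / 2 \<le> integral {0..1} f1"
    using real_trig_poly_minorant[of 0 a "\<epsilon> / 2"] assms by auto
  obtain f2 where f2: "real_trig_poly f2" "\<And>x. f2 x \<le> indicat_real {b<..<1} (frac x)"
      "1 - b - \<epsilon> / 2 \<le> integral {0..1} f2"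
    using real_trig_poly_minorant[of b 1 "\<epsilon> / 2"] assms by auto
  show thesis
  proof
    show "real_trig_poly (\<lambda>x. 1 - f1 x - f2 x)"
      by (intro real_trig_poly_diff real_trig_poly_const f1 f2)
    show "indicat_real {a<..<b} (frac x) \<le> 1 - f1 x - f2 x" for x
    proof -
      have "indicat_real {0<..<a} (frac x) + indicat_real {b<..<1} (frac x) + indicat_real {a<..<b} (frac x) \<le> 1"
        using ab by (auto simp: indicator_def)
      then show ?thesis using f1(2)[of x] f2(2)[of x] by linarith
    qed
    have "integral {0..1} (\<lambda>x. 1 - f1 x - f2 x) = 1 - integral {0..1} f1 - integral {0..1} f2"
      by (simp add: Henstock_Kurzweil_Integration.integral_diff real_trig_poly_integrable f1 f2
          real_trig_poly_const real_trig_poly_diff integrable_diff)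
    then show "integral {0..1} (\<lambda>x. 1 - f1 x - f2 x) \<le> b - a + \<epsilon>" using f1(3) f2(3) by simp
  qed
qed

section \<open>Weyl's criterion in two dimensions\<close>

definition weyl2 :: "(nat \<Rightarrow> real) \<Rightarrow> (nat \<Rightarrow> real) \<Rightarrow> bool" where
  "weyl2 x y \<longleftrightarrow> (\<forall>k l :: int. (k, l) \<noteq> (0, 0) \<longrightarrow>
     (\<lambda>N. (\<Sum>n\<in>{1..N}. ee (of_int k * x n + of_int l * y n)) / of_nat N) \<longlonglongrightarrow> 0)"

lemma weyl2_mean_char:
  assumes "weyl2 x y"
  shows "(\<lambda>N. (\<Sum>n\<in>{1..N}. ee (of_int k * x n + of_int l * y n)) / of_nat N)
    \<longlonglongrightarrow> (if k = 0 \<and> l = 0 then 1 else 0)"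
proof (cases "k = 0 \<and> l = 0")
  case True
  have "\<forall>\<^sub>F N in sequentially. (\<Sum>n\<in>{1..N}. ee (of_int k * x n + of_int l * y n)) / of_nat N = 1"
    using eventually_gt_at_top[of 0] by eventually_elim (simp add: True)
  then show ?thesis using True by (simp add: tendsto_eventually)
qed (use assms in \<open>auto simp: weyl2_def\<close>)

lemma weyl2_mean_trig_poly:
  assumes weyl: "weyl2 x y" and "trig_poly f" "trig_poly g"
  shows "(\<lambda>N. (\<Sum>n\<in>{1..N}. f (x n) * g (y n)) / of_nat N) \<longlonglongrightarrow> integral {0..1} f * integral {0..1} g"
  using \<open>trig_poly f\<close>
proof (induction rule: trig_poly.induct)
  case (char c k)
  show ?case using \<open>trig_poly g\<close>
  proof (induction rule: trig_poly.induct)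
    case (char c' l)
    have scaled: "(\<Sum>n\<in>{1..N}. c * ee (of_int k * x n) * (c' * ee (of_int l * y n))) / of_nat N
        = c * c' * ((\<Sum>n\<in>{1..N}. ee (of_int k * x n + of_int l * y n)) / of_nat N)" for N
      by (simp add: ee_add sum_distrib_left mult_ac)
    show ?case
      using tendsto_mult_left[OF weyl2_mean_char[OF weyl, of k l], of "c * c'"]
      unfolding integral_char scaled by (auto split: if_splits)
  next
    case (add g1 g2)
    have "integral {0..1} (\<lambda>x. g1 x + g2 x) = integral {0..1} g1 + integral {0..1} g2"
      by (intro Henstock_Kurzweil_Integration.integral_add trig_poly_integrable add.hyps)
    with tendsto_add[OF add.IH] show ?case
      by (simp add: distrib_left sum.distrib add_divide_distrib)
  qed
next
  case (add f1 f2)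
  have "integral {0..1} (\<lambda>x. f1 x + f2 x) = integral {0..1} f1 + integral {0..1} f2"
    by (intro Henstock_Kurzweil_Integration.integral_add trig_poly_integrable add.hyps)
  with tendsto_add[OF add.IH] show ?case
    by (simp add: distrib_right sum.distrib add_divide_distrib)
qed

lemma weyl2_mean_real_trig_poly:
  assumes weyl: "weyl2 x y" and f: "real_trig_poly f" and g: "real_trig_poly g"
  shows "(\<lambda>N. (\<Sum>n\<in>{1..N}. f (x n) * g (y n)) / real N) \<longlonglongrightarrow> integral {0..1} f * integral {0..1} g"
proof -
  have integral_of_real: "integral {0..1} (\<lambda>x. complex_of_real (h x)) = of_real (integral {0..1} h)"
    if "real_trig_poly h" for h
    using has_integral_of_real[OF integrable_integral[OF real_trig_poly_integrable[OF that]]]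
    by (rule integral_unique)
  have "(\<lambda>N. complex_of_real ((\<Sum>n\<in>{1..N}. f (x n) * g (y n)) / real N))
      \<longlonglongrightarrow> complex_of_real (integral {0..1} f * integral {0..1} g)"
    using weyl2_mean_trig_poly[OF weyl f[unfolded real_trig_poly_def] g[unfolded real_trig_poly_def]]
    by (simp add: integral_of_real f g)
  then show ?thesis by (simp only: tendsto_of_real_iff)
qed

definition rectangle_frequency ::
  "(nat \<Rightarrow> real) \<Rightarrow> (nat \<Rightarrow> real) \<Rightarrow> real \<Rightarrow> real \<Rightarrow> real \<Rightarrow> real \<Rightarrow> nat \<Rightarrow> real" where
  "rectangle_frequency x y a b c d N =
    (\<Sum>n\<in>{1..N}. indicat_real {a<..<b} (frac (x n)) * indicat_real {c<..<d} (frac (y n))) / real N"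

lemma weyl2_rectangle_frequency_upper:
  assumes weyl: "weyl2 x y" and ab: "0 \<le> a" "a < b" "b \<le> 1" and cd: "0 \<le> c" "c < d" "d \<le> 1" and \<epsilon>: "\<epsilon> > 0"
  obtains U u where "U \<longlonglongrightarrow> u" "u \<le> (b - a + \<epsilon>) * (d - c + \<epsilon>)"
    "\<And>N. rectangle_frequency x y a b c d N \<le> U N"
proof -
  obtain F where F: "real_trig_poly F" "\<And>x. indicat_real {a<..<b} (frac x) \<le> F x"
      "integral {0..1} F \<le> b - a + \<epsilon>"
    by (rule real_trig_poly_majorant[OF ab \<epsilon>]) (rule that)
  obtain G where G: "real_trig_poly G" "\<And>x. indicat_real {c<..<d} (frac x) \<le> G x"
      "integral {0..1} G \<le> d - c + \<epsilon>"
    by (rule real_trig_poly_majorant[OF cd \<epsilon>]) (rule that)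
  have F_nonneg: "0 \<le> F x" and G_nonneg: "0 \<le> G x" for x
    using order.trans[OF indicator_pos_le F(2)] order.trans[OF indicator_pos_le G(2)] by auto
  show thesis
  proof
    show "(\<lambda>N. (\<Sum>n\<in>{1..N}. F (x n) * G (y n)) / real N) \<longlonglongrightarrow> integral {0..1} F * integral {0..1} G"
      by (intro weyl2_mean_real_trig_poly weyl F G)
    show "integral {0..1} F * integral {0..1} G \<le> (b - a + \<epsilon>) * (d - c + \<epsilon>)"
      using F(3) G(3) F_nonneg G_nonneg ab \<epsilon>
      by (intro mult_mono)
        (auto intro!: Henstock_Kurzweil_Integration.integral_nonneg real_trig_poly_integrable F(1) G(1))
    show "rectangle_frequency x y a b c d N \<le> (\<Sum>n\<in>{1..N}. F (x n) * G (y n)) / real N" for N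
      unfolding rectangle_frequency_def
      by (intro divide_right_mono sum_mono mult_mono F(2) G(2) F_nonneg) auto
  qed
qed

text \<open>Minorants take negative values, so they cannot be multiplied; instead \<open>I J = I - I (1 - J)\<close>, and the
  subtracted product has nonnegative majorants.\<close>

lemma indicator_product_minorant:
  fixes f g F :: real
  assumes "f \<le> indicat_real A s" "indicat_real A s \<le> F" "g \<le> indicat_real B t"
  shows "f - F * (1 - g) \<le> indicat_real A s * indicat_real B t"
proof -
  have "0 \<le> F" using order.trans[OF indicator_pos_le assms(2)] .
  then have "indicat_real A s * (1 - indicat_real B t) \<le> F * (1 - g)"
    using assms(2,3) by (intro mult_mono) (auto simp: indicator_def)
  then show ?thesis using assms(1) by (simp add: algebra_simps)
qed

lemma weyl2_rectangle_frequency_lower: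
  assumes weyl: "weyl2 x y" and ab: "0 \<le> a" "a < b" "b \<le> 1" and cd: "0 \<le> c" "c < d" "d \<le> 1" and \<epsilon>: "\<epsilon> > 0"
  obtains V v where "V \<longlonglongrightarrow> v" "(b - a - \<epsilon>) - (b - a + \<epsilon>) * (1 - (d - c) + \<epsilon>) \<le> v"
    "\<And>N. V N \<le> rectangle_frequency x y a b c d N"
proof -
  obtain f where f: "real_trig_poly f" "\<And>x. f x \<le> indicat_real {a<..<b} (frac x)"
      "b - a - \<epsilon> \<le> integral {0..1} f"
    by (rule real_trig_poly_minorant[OF ab(1,3) \<epsilon>]) (rule that)
  obtain g where g: "real_trig_poly g" "\<And>x. g x \<le> indicat_real {c<..<d} (frac x)"
      "d - c - \<epsilon> \<le> integral {0..1} g"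
    by (rule real_trig_poly_minorant[OF cd(1,3) \<epsilon>]) (rule that)
  obtain F where F: "real_trig_poly F" "\<And>x. indicat_real {a<..<b} (frac x) \<le> F x"
      "integral {0..1} F \<le> b - a + \<epsilon>"
    by (rule real_trig_poly_majorant[OF ab \<epsilon>]) (rule that)
  have F_nonneg: "0 \<le> F x" for x using order.trans[OF indicator_pos_le F(2)] .
  have one_minus_g: "real_trig_poly (\<lambda>x. 1 - g x)"
    by (intro real_trig_poly_diff real_trig_poly_const g(1))
  let ?V = "\<lambda>N. (\<Sum>n\<in>{1..N}. f (x n) * 1) / real N - (\<Sum>n\<in>{1..N}. F (x n) * (1 - g (y n))) / real N"
  show thesis
  proof
    have "?V \<longlonglongrightarrow> integral {0..1} f * integral {0..1 :: real} (\<lambda>x. 1)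
        - integral {0..1} F * integral {0..1} (\<lambda>x. 1 - g x)"
      by (intro tendsto_diff weyl2_mean_real_trig_poly[OF weyl f(1) real_trig_poly_const]
          weyl2_mean_real_trig_poly[OF weyl F(1) one_minus_g])
    then show "?V \<longlonglongrightarrow> integral {0..1} f - integral {0..1} F * (1 - integral {0..1} g)"
      by (simp add: integral_one_minus_real_trig_poly g(1))
    have "0 \<le> integral {0..1} F"
      by (intro Henstock_Kurzweil_Integration.integral_nonneg real_trig_poly_integrable F(1) F_nonneg)
    then have "integral {0..1} F * (1 - integral {0..1} g) \<le> integral {0..1} F * (1 - (d - c) + \<epsilon>)"
      using g(3) by (intro mult_left_mono) auto
    also have "\<dots> \<le> (b - a + \<epsilon>) * (1 - (d - c) + \<epsilon>)"
      using F(3) cd \<epsilon> by (intro mult_right_mono) auto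
    finally show "(b - a - \<epsilon>) - (b - a + \<epsilon>) * (1 - (d - c) + \<epsilon>)
        \<le> integral {0..1} f - integral {0..1} F * (1 - integral {0..1} g)"
      using f(3) by simp
    show "?V N \<le> rectangle_frequency x y a b c d N" for N
      unfolding rectangle_frequency_def diff_divide_distrib[symmetric] sum_subtractf[symmetric]
      using indicator_product_minorant[OF f(2) F(2) g(2)]
      by (intro divide_right_mono sum_mono) simp_all
  qed
qed

lemma at_right_0_witness:
  fixes \<phi> :: "real \<Rightarrow> 'a::topological_space"
  assumes "(\<phi> \<longlongrightarrow> l) (at_right 0)" "open S" "l \<in> S"
  obtains \<epsilon> where "\<epsilon> > 0" "\<phi> \<epsilon> \<in> S"
proof -
  have "\<forall>\<^sub>F \<epsilon> in at_right 0. 0 < \<epsilon> \<and> \<phi> \<epsilon> \<in> S"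
    using eventually_at_right_less topological_tendstoD[OF assms] by (rule eventually_conj)
  then obtain \<epsilon> where "0 < \<epsilon> \<and> \<phi> \<epsilon> \<in> S" using eventually_happens by force
  then show thesis by (blast intro: that)
qed

lemma weyl2_rectangle_frequency_tendsto:
  assumes weyl: "weyl2 x y" and ab: "0 \<le> a" "a < b" "b \<le> 1" and cd: "0 \<le> c" "c < d" "d \<le> 1"
  shows "rectangle_frequency x y a b c d \<longlonglongrightarrow> (b - a) * (d - c)"
proof (rule order_tendstoI)
  fix e assume e: "(b - a) * (d - c) < e"
  have "((\<lambda>\<epsilon>. (b - a + \<epsilon>) * (d - c + \<epsilon>)) \<longlongrightarrow> (b - a + 0) * (d - c + 0)) (at_right 0)"
    by (intro tendsto_intros)
  then obtain \<epsilon> where \<epsilon>: "\<epsilon> > 0" "(b - a + \<epsilon>) * (d - c + \<epsilon>) \<in> {..<e}"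
    by (rule at_right_0_witness[OF _ open_lessThan]) (use e in simp, rule that)
  obtain U u where U: "U \<longlonglongrightarrow> u" "u \<le> (b - a + \<epsilon>) * (d - c + \<epsilon>)" "\<And>N. rectangle_frequency x y a b c d N \<le> U N"
    by (rule weyl2_rectangle_frequency_upper[OF weyl ab cd \<epsilon>(1)]) (rule that)
  have "\<forall>\<^sub>F N in sequentially. U N < e"
    by (rule order_tendstoD[OF U(1)]) (use U(2) \<epsilon>(2) in simp)
  then show "\<forall>\<^sub>F N in sequentially. rectangle_frequency x y a b c d N < e"
    by eventually_elim (use U(3) le_less_trans in blast)
next
  fix e assume e: "e < (b - a) * (d - c)"
  let ?low = "\<lambda>\<epsilon>. (b - a - \<epsilon>) - (b - a + \<epsilon>) * (1 - (d - c) + \<epsilon>)"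
  have "(?low \<longlongrightarrow> (b - a - 0) - (b - a + 0) * (1 - (d - c) + 0)) (at_right 0)"
    by (intro tendsto_intros)
  then obtain \<epsilon> where \<epsilon>: "\<epsilon> > 0" "?low \<epsilon> \<in> {e<..}"
    by (rule at_right_0_witness[OF _ open_greaterThan]) (use e in \<open>simp add: algebra_simps\<close>, rule that)
  obtain V v where V: "V \<longlonglongrightarrow> v" "?low \<epsilon> \<le> v" "\<And>N. V N \<le> rectangle_frequency x y a b c d N"
    by (rule weyl2_rectangle_frequency_lower[OF weyl ab cd \<epsilon>(1)]) (rule that)
  have "\<forall>\<^sub>F N in sequentially. e < V N"
    by (rule order_tendstoD[OF V(1)]) (use V(2) \<epsilon>(2) in simp)
  then show "\<forall>\<^sub>F N in sequentially. e < rectangle_frequency x y a b c d N"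
    by eventually_elim (use V(3) less_le_trans in blast)
qed

theorem weyl2_imp_ud_mod1_2:
  assumes "weyl2 x y"
  shows "ud_mod1_2 (\<lambda>n. (x n, y n))"
proof -
  have "real (card {n\<in>{1..N}. frac (x n) \<in> {a<..<b} \<and> frac (y n) \<in> {c<..<d}}) / real N
      = rectangle_frequency x y a b c d N" for a b c d N
  proof -
    have "(\<Sum>n\<in>{1..N}. indicat_real {a<..<b} (frac (x n)) * indicat_real {c<..<d} (frac (y n)))
        = (\<Sum>n\<in>{1..N}. if frac (x n) \<in> {a<..<b} \<and> frac (y n) \<in> {c<..<d} then 1 else 0)"
      by (intro sum.cong refl) (auto simp: indicator_def)
    then show ?thesis by (simp add: rectangle_frequency_def sum.If_cases Int_def)
  qed
  then show ?thesis
    using weyl2_rectangle_frequency_tendsto[OF assms] by (simp add: ud_mod1_2_def)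
qed

theorem mainTheorem7:
  fixes b :: nat and D :: "nat set"
  assumes "b \<ge> 3" and "D \<subseteq> {0..<b}" and "0 \<in> D" and "2 \<le> card D" and "card D < b"
  shows "(\<forall>d c. has_irr_nonconst_coeff d c \<longrightarrow>
            avg_tends_zero (\<lambda>n. ee (poly2 d c (real (kseq b D n)) (real (digsum b (kseq b D n))))))
       \<and> (\<forall>d c1 c2. (\<forall>m1 m2 :: int. (m1, m2) \<noteq> (0, 0) \<longrightarrow>
                       has_irr_nonconst_coeff d (\<lambda>i j. of_int m1 * c1 i j + of_int m2 * c2 i j)) \<longrightarrow>
            ud_mod1_2 (\<lambda>n. (poly2 d c1 (real (kseq b D n)) (real (digsum b (kseq b D n))),
                            poly2 d c2 (real (kseq b D n)) (real (digsum b (kseq b D n)))))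
          \<and> (\<forall>m1 m2 :: int. (m1, m2) \<noteq> (0, 0) \<longrightarrow>
               avg_tends_zero (\<lambda>n. ee (of_int m1 * poly2 d c1 (real (kseq b D n)) (real (digsum b (kseq b D n)))
                                      + of_int m2 * poly2 d c2 (real (kseq b D n)) (real (digsum b (kseq b D n)))))))"
proof (intro conjI allI impI)
  let ?value = "\<lambda>d c n. poly2 d c (real (kseq b D n)) (real (digsum b (kseq b D n)))"
  show avg: "avg_tends_zero (\<lambda>n. ee (?value d c n))" if "has_irr_nonconst_coeff d c" for d c
    using that assms by (intro avg_tends_zero_kseq) auto
  fix d c1 c2
  assume irr: "\<forall>m1 m2 :: int. (m1, m2) \<noteq> (0, 0) \<longrightarrow>
    has_irr_nonconst_coeff d (\<lambda>i j. of_int m1 * c1 i j + of_int m2 * c2 i j)"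
  show avg_combination: "avg_tends_zero (\<lambda>n. ee (of_int m1 * ?value d c1 n + of_int m2 * ?value d c2 n))"
    if "(m1, m2) \<noteq> (0, 0)" for m1 m2 :: int
    using avg[OF irr[rule_format, OF that]] by (simp add: poly2_add poly2_cmult)
  then have "weyl2 (?value d c1) (?value d c2)"
    unfolding weyl2_def by (intro allI impI avg_tends_zero_imp_mean_tendsto_0)
  then show "ud_mod1_2 (\<lambda>n. (?value d c1 n, ?value d c2 n))"
    by (rule weyl2_imp_ud_mod1_2)
qed

end
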